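(* For every $y>0$, $$\lim_{N\to\infty}\mu\left\{x\in(0,1):\ \max_{1\le n\le N}a_n(x)\le \frac{2Ny}{\log(2+\sqrt3)}\right\}=\exp\left(-\frac1y\right),$$ where $a_n(x)$ is the integer part of the $n$-th digit of the spliced continued fraction expansion of $x$, and $\mu$ is the ($T$-invariant, absolutely continuous) probability measure of the spliced continued fraction map $T$.
   Context: Let $\mathscr A=\{(k,\varepsilon)_s: k\ge 2 \text{ an integer},\ \varepsilon\in\{1,-1\},\ s\in\{e,o\}\}\cup\{(1,1)_e\}$ be a set of formal symbols. Define intervals $I_{(1,+1)_e}=[\frac13,\frac12]$ and, for $k\ge2$, $I_{(k,+1)_e}=[\frac1{2k+1},\frac1{2k})$, $I_{(k,-1)_e}=[\frac1{2k},\frac1{2k-1})$, $I_{(k,-1)_o}=(\frac{k-1}{k},\frac{2k-1}{2k+1}]$, $I_{(k,+1)_o}=(\frac{2k-1}{2k+1},\frac{k}{k+1}]$. These partition $(0,1)$. The spliced continued fraction (SCF) map $T:[0,1]\to[0,1]$ is given by $T(0)=0$, $T(1)=1$, and $T(x)=\frac1x-2k$ on $I_{(k,+1)_e}$ ($k\ge1$); $T(x)=2k-\frac1x$ on $I_{(k,-1)_e}$ ($k\ge2$); $T(x)=\frac{kx-(k-1)}{k-(k+1)x}$ on $I_{(k,-1)_o}$ ($k\ge2$); $T(x)=\frac{k-(k+1)x}{kx-(k-1)}$ on $I_{(k,+1)_o}$ ($k\ge2$). For irrational $x\in(0,1)$ and $n\ge1$, the $n$-th SCF digit of $x$ is the unique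 symbol $(a_n(x),\varepsilon_n(x))_{s_n(x)}\in\mathscr A$ with $T^{n-1}x\in I_{(a_n(x),\varepsilon_n(x))_{s_n(x)}}$. (Rational $x$ have finite expansions and form a null set.) The $T$-invariant probability measure is $d\mu(x)=\frac{2}{\log(2+\sqrt3)}\cdot\frac{1}{(1-(2-\sqrt3)x)(1+\sqrt3x)}\,dx$ on $[0,1]$. *)

theory Defs
  imports "HOL-Analysis.Analysis"
begin

datatype scf_parity = Par_e | Par_o

text \<open>The symbol \<open>(k, \<epsilon>)\<^sub>s\<close> is the triple \<open>(k, \<epsilon>, s)\<close>.\<close>

type_synonym scf_symbol = "nat \<times> int \<times> scf_parity"

definition scf_alphabet :: "scf_symbol set" where
  "scf_alphabet = {(k, \<epsilon>, s). k \<ge> 2 \<and> \<epsilon> \<in> {1, -1}} \<union> {(1, 1, Par_e)}"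

text \<open>The values of the next two functions outside \<^const>\<open>scf_alphabet\<close> are irrelevant.\<close>

fun scf_interval :: "scf_symbol \<Rightarrow> real set" where
  "scf_interval (k, \<epsilon>, Par_e) =
     (if k = 1 then {1/3 .. 1/2}
      else if \<epsilon> = 1 then {1 / (2 * real k + 1) ..< 1 / (2 * real k)}
      else {1 / (2 * real k) ..< 1 / (2 * real k - 1)})"
| "scf_interval (k, \<epsilon>, Par_o) =
     (if \<epsilon> = 1 then {(2 * real k - 1) / (2 * real k + 1) <.. real k / (real k + 1)}
      else {(real k - 1) / real k <.. (2 * real k - 1) / (2 * real k + 1)})"

fun scf_branch :: "scf_symbol \<Rightarrow> real \<Rightarrow> real" where
  "scf_branch (k, \<epsilon>, Par_e) x =
     (if \<epsilon> = 1 then 1 / x - 2 * real k else 2 * real k - 1 / x)"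
| "scf_branch (k, \<epsilon>, Par_o) x =
     (if \<epsilon> = 1
      then (real k - (real k + 1) * x) / (real k * x - (real k - 1))
      else (real k * x - (real k - 1)) / (real k - (real k + 1) * x))"

text \<open>The intervals indexed by \<^const>\<open>scf_alphabet\<close> partition \<open>(0,1)\<close>, so the
  description below is proper exactly for \<open>x \<in> (0,1)\<close>.\<close>

definition scf_symbol_of :: "real \<Rightarrow> scf_symbol" where
  "scf_symbol_of x = (THE \<omega>. \<omega> \<in> scf_alphabet \<and> x \<in> scf_interval \<omega>)"

text \<open>Only \<open>x \<in> [0,1]\<close> matters; the last case gives \<open>T(0) = 0\<close> and \<open>T(1) = 1\<close>.\<close>

definition scf_map :: "real \<Rightarrow> real" where
  "scf_map x = (if 0 < x \<and> x < 1 then scf_branch (scf_symbol_of x) x else x)"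

text \<open>Digits are indexed from \<open>n = 1\<close> and are meaningful for irrational \<open>x \<in> (0,1)\<close>,
  whose orbit stays in \<open>(0,1)\<close>; the orbit of a rational point ends in \<open>0\<close> or \<open>1\<close>.\<close>

definition scf_digit :: "nat \<Rightarrow> real \<Rightarrow> scf_symbol" where
  "scf_digit n x = scf_symbol_of ((scf_map ^^ (n - 1)) x)"

definition scf_a :: "nat \<Rightarrow> real \<Rightarrow> nat" where
  "scf_a n x = fst (scf_digit n x)"

definition scf_density :: "real \<Rightarrow> real" where
  "scf_density x =
     2 / ln (2 + sqrt 3) * (1 / ((1 - (2 - sqrt 3) * x) * (1 + sqrt 3 * x)))"

definition scf_measure :: "real measure" where
  "scf_measure = density lborel (\<lambda>x. ennreal (indicator {0..1} x * scf_density x))"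

end

theory Submission
  imports Defs "HOL-Real_Asymp.Real_Asymp"
begin

text \<open>
  Let \<open>P\<close> be the transfer operator of the map normalised by the invariant density, and \<open>P\<^sub>M\<close> its
  restriction to the branches with integer part at most \<open>M\<close>. Then
  \<open>\<mu>{a\<^sub>1, \<dots>, a\<^sub>N \<le> M} = \<integral> P\<^sub>M\<^sup>N 1 d\<mu>\<close>. In the coordinate that makes \<open>\<mu>\<close> uniform, every branch
  probability is a log-Lipschitz function with constant \<open>1\<close> and every inverse branch contracts by
  \<open>1/4\<close>, so that \<open>P\<^sub>M\<close> maps functions with Lipschitz constant \<open>l\<close> to functions with Lipschitz
  constant \<open>\<rho> l + 3/M\<close>, where \<open>\<rho> = 1/4 + ln (2 + \<surd>3) / 2 < 1\<close>. Hence all iterates \<open>P\<^sub>M\<^sup>n 1\<close> are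
  constant up to \<open>O(1/M)\<close>, uniformly in \<open>n\<close>, and with \<open>q = \<mu>{a\<^sub>1 > M}\<close> the numbers
  \<open>m\<^sub>n = \<integral> P\<^sub>M\<^sup>n 1 d\<mu>\<close> satisfy \<open>m\<^sub>n\<^sub>+\<^sub>1 = (1 - q) m\<^sub>n + O(q/M)\<close>. Therefore
  \<open>m\<^sub>N = (1 - q)\<^sup>N + O(N q/M)\<close>, and the theorem follows from \<open>q \<sim> 2 / (M ln (2 + \<surd>3))\<close>.
\<close>

section \<open>The invariant density and its coordinate\<close>

text \<open>The cutoff \<open>M\<close> grows with \<open>N\<close>, so every estimate has to be
  uniform in it, and all constants are explicit. The contraction is tight: \<rho> is about 0.91. Its
  summand \<open>1/4\<close> comes from the inverse branches, the other one from the change of the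
  branch probabilities between two points at distance \<open>d\<close> in the coordinate. Each
  probability changes by at most \<open>d/2\<close> times the sum of its two values; since the
  probabilities add up to at most 1, the total change is at most \<open>d\<close>. It is tested
  against \<open>f\<close> minus the value of \<open>f\<close> at the midpoint of the coordinate
  range, which replaces the full diameter \<open>ln (2 + sqrt 3)\<close>, about 1.32, by its half;
  the full diameter would give a constant above 1. The term \<open>3/M\<close> arises because the
  restricted operator does not fix constants. As \<open>N\<close> has the order of \<open>M\<close>,
  a one-step error \<open>O(1/M)\<close> would add up to \<open>O(1)\<close>. The extra factor
  \<open>q\<close>, of order \<open>1/M\<close>, is what saves the argument: the deviation of the
  iterate from its mean is felt only on the discarded set, of measure \<open>q\<close>.\<close>

definition scf_weight :: "real \<Rightarrow> real" where
  "scf_weight x = (1 - (2 - sqrt 3) * x) * (1 + sqrt 3 * x)"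

text \<open>The derivative of \<open>scf_coord\<close> is \<open>2 / scf_weight\<close>, a multiple of the invariant density;
  all Lipschitz estimates are with respect to this coordinate.\<close>

definition scf_coord :: "real \<Rightarrow> real" where
  "scf_coord x = ln ((1 + sqrt 3 * x) / (1 - (2 - sqrt 3) * x))"

lemma sqrt_3_bounds: "173/100 < sqrt 3" "sqrt 3 < 1733/1000"
proof -
  show "173/100 < sqrt 3" by (rule real_less_rsqrt) (simp add: power2_eq_square)
  show "sqrt 3 < 1733/1000" by (rule real_less_lsqrt) (simp_all add: power2_eq_square)
qed

lemma sqrt_3_mult_self: "sqrt 3 * sqrt 3 = (3::real)"
  by simp

lemma scf_factors_pos:
  assumes "0 \<le> x" "x \<le> 1"
  shows "0 < 1 - (2 - sqrt 3) * x" "0 < 1 + sqrt 3 * x"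
proof -
  have "(2 - sqrt 3) * x \<le> (2 - sqrt 3) * 1"
    using assms sqrt_3_bounds by (intro mult_left_mono) auto
  also have "\<dots> < 1" using sqrt_3_bounds by simp
  finally show "0 < 1 - (2 - sqrt 3) * x" by simp
  show "0 < 1 + sqrt 3 * x" using assms sqrt_3_bounds by (simp add: add_pos_nonneg)
qed

lemma scf_weight_pos: "0 \<le> x \<Longrightarrow> x \<le> 1 \<Longrightarrow> 0 < scf_weight x"
  unfolding scf_weight_def using scf_factors_pos by simp

lemma scf_weight_eq: "scf_weight x = 1 + (2 * sqrt 3 - 2) * x + (3 - 2 * sqrt 3) * x\<^sup>2"
proof -
  define w where "w = sqrt 3"
  have "w * w = 3" unfolding w_def by (rule sqrt_3_mult_self)
  moreover have "(1 - (2 - w) * x) * (1 + w * x) = 1 + (2 * w - 2) * x + (w * w - 2 * w) * x\<^sup>2"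
    by (simp add: algebra_simps power2_eq_square)
  ultimately have "(1 - (2 - w) * x) * (1 + w * x) = 1 + (2 * w - 2) * x + (3 - 2 * w) * x\<^sup>2"
    by (simp only:)
  then show ?thesis unfolding scf_weight_def w_def .
qed

lemma scf_weight_le_2:
  assumes "0 \<le> x" "x \<le> 1" shows "scf_weight x \<le> 2"
proof -
  have "2 - scf_weight x = (1 - x) * (1 + (3 - 2 * sqrt 3) * x)"
    unfolding scf_weight_eq by (simp add: algebra_simps power2_eq_square)
  moreover have "(2 * sqrt 3 - 3) * x \<le> (2 * sqrt 3 - 3) * 1"
    using assms sqrt_3_bounds by (intro mult_left_mono) auto
  then have "0 \<le> 1 + (3 - 2 * sqrt 3) * x" using sqrt_3_bounds by (simp add: algebra_simps)
  then have "0 \<le> (1 - x) * (1 + (3 - 2 * sqrt 3) * x)" using assms by (intro mult_nonneg_nonneg) auto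
  ultimately show ?thesis by linarith
qed

lemma scf_coord_deriv:
  assumes "0 \<le> x" "x \<le> 1"
  shows "(scf_coord has_real_derivative 2 / scf_weight x) (at x within X)"
proof -
  note p = scf_factors_pos[OF assms]
  have n: "1 - (2 - sqrt 3) * x \<noteq> 0" "1 + sqrt 3 * x \<noteq> 0" using p by auto
  have "(scf_coord has_real_derivative
     (sqrt 3 * (1 - (2 - sqrt 3) * x) - (1 + sqrt 3 * x) * (- (2 - sqrt 3))) /
       ((1 - (2 - sqrt 3) * x) * (1 - (2 - sqrt 3) * x)) /
       ((1 + sqrt 3 * x) / (1 - (2 - sqrt 3) * x))) (at x within X)"
    unfolding scf_coord_def using p n
    by (auto intro!: derivative_eq_intros divide_pos_pos simp: field_simps)
  also have "sqrt 3 * (1 - (2 - sqrt 3) * x) - (1 + sqrt 3 * x) * (- (2 - sqrt 3)) = 2"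
    by (simp add: algebra_simps)
  also have "2 / ((1 - (2 - sqrt 3) * x) * (1 - (2 - sqrt 3) * x)) /
       ((1 + sqrt 3 * x) / (1 - (2 - sqrt 3) * x)) = 2 / scf_weight x"
    unfolding scf_weight_def using n by (simp add: divide_simps)
  finally show ?thesis .
qed

lemma scf_coord_0: "scf_coord 0 = 0"
  by (simp add: scf_coord_def)

lemma scf_coord_1: "scf_coord 1 = ln (2 + sqrt 3)"
proof -
  have "(1 + sqrt 3) / (sqrt 3 - 1) = 2 + sqrt 3"
    using sqrt_3_bounds by (simp add: field_simps)
  then show ?thesis by (simp add: scf_coord_def algebra_simps)
qed

lemma scf_coord_mono:
  assumes "0 \<le> x" "x \<le> y" "y \<le> 1" shows "scf_coord x \<le> scf_coord y"
proof (rule deriv_nonneg_imp_mono[of x y scf_coord "\<lambda>t. 2 / scf_weight t"])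
  fix t assume "t \<in> {x..y}"
  then have t: "0 \<le> t" "t \<le> 1" using assms by auto
  show "(scf_coord has_real_derivative 2 / scf_weight t) (at t)" by (rule scf_coord_deriv[OF t])
  show "2 / scf_weight t \<ge> 0" using scf_weight_pos[OF t] by simp
qed (use assms in auto)

lemma scf_coord_diam:
  assumes "x \<in> {0..1}" "y \<in> {0..1}"
  shows "\<bar>scf_coord x - scf_coord y\<bar> \<le> ln (2 + sqrt 3)"
  using scf_coord_mono[of 0 x] scf_coord_mono[of 0 y] scf_coord_mono[of x 1] scf_coord_mono[of y 1]
    assms scf_coord_0 scf_coord_1 by auto

text \<open>The upper bound is what makes \<open>1/4 + ln (2 + sqrt 3) / 2\<close> smaller than
  1.\<close>

lemma ln_2_sqrt_3: "0 < ln (2 + sqrt 3)" "ln (2 + sqrt 3) < 3/2"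
proof -
  show "0 < ln (2 + sqrt 3)" using sqrt_3_bounds by simp
  \<comment> \<open>\<open>(5/4) ^ 6\<close> is about 3.81, just above \<open>2 + sqrt 3\<close>,
    about 3.73.\<close>
  have "1 + (1/4) \<le> exp (1/4::real)" by (rule exp_ge_add_one_self)
  then have "(5/4) ^ 6 \<le> exp (1/4::real) ^ 6" by (intro power_mono) auto
  also have "exp (1/4::real) ^ 6 = exp (3/2)" by (simp flip: exp_of_nat_mult)
  finally have "2 + sqrt 3 < exp (3/2)" using sqrt_3_bounds by (simp add: power_numeral_reduce)
  moreover have "0 < 2 + sqrt 3" using sqrt_3_bounds by simp
  ultimately show "ln (2 + sqrt 3) < 3/2" by (metis ln_exp ln_less_cancel_iff exp_gt_zero)
qed

text \<open>Affine functions that are nonnegative between the two poles \<open>-1/\<surd>3\<close> and \<open>2 + \<surd>3\<close> of the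
  density. In the variable \<open>s = exp (scf_coord y)\<close> they are, up to the common factor
  \<open>1 - (2 - \<surd>3) y\<close>, of the form \<open>\<alpha> + \<beta> s\<close> with \<open>\<alpha>, \<beta> \<ge> 0\<close>; hence the ratio bounds below.\<close>

definition scf_cone :: "(real \<Rightarrow> real) \<Rightarrow> bool" where
  "scf_cone A \<longleftrightarrow> (\<exists>u v. 0 < u \<and> - (2 - sqrt 3) * u \<le> v \<and> v \<le> sqrt 3 * u \<and> (\<forall>y. A y = u + v * y))"

lemma scf_coneI:
  assumes "0 < u" "- (2 - sqrt 3) * u \<le> v" "v \<le> sqrt 3 * u" "\<And>y. A y = u + v * y"
  shows "scf_cone A"
  using assms unfolding scf_cone_def by blast

lemma scf_cone_pos:
  assumes "scf_cone A" "0 \<le> y" "y \<le> 1" shows "0 < A y"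
proof -
  obtain u v where uv: "0 < u" "- (2 - sqrt 3) * u \<le> v" "\<And>y. A y = u + v * y"
    using assms(1) unfolding scf_cone_def by blast
  have "0 < u * (1 - (2 - sqrt 3) * y)" using uv scf_factors_pos[OF assms(2,3)] by simp
  also have "\<dots> = u + (- (2 - sqrt 3) * u) * y" by (simp add: algebra_simps)
  also have "\<dots> \<le> u + v * y" using uv(2) assms by (intro add_left_mono mult_right_mono)
  finally show ?thesis using uv(3) by simp
qed

text \<open>The two cone inequalities are the signs of the derivatives of two quotients:
  \<open>A\<close> over \<open>1 + sqrt 3 * y\<close> is nonincreasing and \<open>A\<close> over
  \<open>1 - (2 - sqrt 3) * y\<close> is nondecreasing.\<close>

lemma scf_cone_cross:
  assumes "scf_cone A" "z \<le> y"
  shows "A y * (1 + sqrt 3 * z) \<le> A z * (1 + sqrt 3 * y)"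
    and "A z * (1 - (2 - sqrt 3) * y) \<le> A y * (1 - (2 - sqrt 3) * z)"
proof -
  obtain u v where uv: "0 < u" "- (2 - sqrt 3) * u \<le> v" "v \<le> sqrt 3 * u" "\<And>y. A y = u + v * y"
    using assms(1) unfolding scf_cone_def by blast
  have "0 \<le> (sqrt 3 * u - v) * (y - z)" using uv assms by simp
  then show "A y * (1 + sqrt 3 * z) \<le> A z * (1 + sqrt 3 * y)"
    unfolding uv by (simp add: algebra_simps)
  have "0 \<le> (v - (- (2 - sqrt 3) * u)) * (y - z)" using uv assms by simp
  then show "A z * (1 - (2 - sqrt 3) * y) \<le> A y * (1 - (2 - sqrt 3) * z)"
    unfolding uv by (simp add: algebra_simps)
qed

text \<open>\<open>tanh (d / 2) \<le> d / 2\<close>, cleared of denominators.\<close>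

lemma exp_minus_one_le:
  fixes d :: real assumes "0 \<le> d" shows "(exp d - 1) \<le> d / 2 * (exp d + 1)"
proof -
  let ?f = "\<lambda>t::real. t / 2 * (exp t + 1) - (exp t - 1)"
  have "?f 0 \<le> ?f d"
  proof (rule deriv_nonneg_imp_mono[of 0 d ?f "\<lambda>t. (1 + (t - 1) * exp t) / 2"])
    fix t :: real assume "t \<in> {0..d}"
    show "(?f has_real_derivative (1 + (t - 1) * exp t) / 2) (at t)"
      by (auto intro!: derivative_eq_intros simp: field_simps)
    have "(1 - t) * exp t \<le> exp (- t) * exp t"
      using exp_ge_add_one_self[of "- t"] by (intro mult_right_mono) auto
    then show "0 \<le> (1 + (t - 1) * exp t) / 2" by (simp add: algebra_simps flip: exp_add)
  qed (use assms in auto)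
  then show ?thesis by simp
qed

text \<open>For positive \<open>p\<close>, \<open>q\<close> the ratio has logarithm at most
  \<open>d\<close> in absolute value, and \<open>(p - q) / (p + q)\<close> is \<open>tanh\<close> of
  half that logarithm. With \<open>p + q\<close> on the right the bound can be summed over
  branches.\<close>

lemma diff_le_of_ratio:
  fixes p q d :: real
  assumes "0 \<le> d" "0 \<le> p + q" "p \<le> exp d * q" "q \<le> exp d * p"
  shows "\<bar>p - q\<bar> \<le> d / 2 * (p + q)"
proof -
  have *: "x - y \<le> d / 2 * (x + y)" if "x \<le> exp d * y" and xy: "0 \<le> x + y" for x y
  proof -
    have "(exp d + 1) * (x - y) \<le> (exp d - 1) * (x + y)" using that(1) by (simp add: algebra_simps)
    also have "\<dots> \<le> d / 2 * (exp d + 1) * (x + y)"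
      using exp_minus_one_le[OF assms(1)] xy by (intro mult_right_mono) auto
    finally have "(exp d + 1) * (x - y) \<le> (exp d + 1) * (d / 2 * (x + y))" by (simp add: algebra_simps)
    then show ?thesis by (rule mult_left_le_imp_le) (simp add: add_pos_pos)
  qed
  have "p - q \<le> d / 2 * (p + q)" "q - p \<le> d / 2 * (p + q)"
    using *[of p q] *[of q p] assms by (simp_all add: add.commute)
  then show ?thesis by linarith
qed

text \<open>Let \<open>f\<close>, \<open>g\<close> be the two factors of the weight, so that
  \<open>g / f = exp scf_coord\<close>. Then \<open>Q\<close> is \<open>exp scf_coord\<close> times
  the nonincreasing function \<open>f^2 / (A * B)\<close>, and also \<open>exp (- scf_coord)\<close>
  times the nondecreasing function \<open>g^2 / (A * B)\<close>. Hence \<open>ln Q\<close> has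
  Lipschitz constant 1 in the coordinate.\<close>

lemma scf_cone_quotient:
  assumes "scf_cone A" "scf_cone B" "y \<in> {0..1}" "z \<in> {0..1}"
  defines "Q \<equiv> \<lambda>y. scf_weight y / (A y * B y)"
  shows "\<bar>Q y - Q z\<bar> \<le> \<bar>scf_coord y - scf_coord z\<bar> / 2 * (Q y + Q z)"
proof -
  have *: "\<bar>Q y - Q z\<bar> \<le> \<bar>scf_coord y - scf_coord z\<bar> / 2 * (Q y + Q z)"
    if yz: "z \<le> y" "0 \<le> z" "y \<le> 1" for y z
  proof (rule diff_le_of_ratio)
    define f g :: "real \<Rightarrow> real" where "f t = 1 - (2 - sqrt 3) * t" and "g t = 1 + sqrt 3 * t" for t
    have y: "0 \<le> y" and z: "z \<le> 1" using yz by auto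
    have pos: "0 < f y" "0 < g y" "0 < f z" "0 < g z" "0 < A y" "0 < A z" "0 < B y" "0 < B z"
      unfolding f_def g_def using scf_factors_pos[OF y yz(3)] scf_factors_pos[OF yz(2) z]
        scf_cone_pos[OF assms(1) y yz(3)] scf_cone_pos[OF assms(2) y yz(3)]
        scf_cone_pos[OF assms(1) yz(2) z] scf_cone_pos[OF assms(2) yz(2) z] by auto
    have W: "scf_weight t = f t * g t" for t unfolding scf_weight_def f_def g_def by simp
    have c: "A y * g z \<le> A z * g y" "A z * f y \<le> A y * f z"
      "B y * g z \<le> B z * g y" "B z * f y \<le> B y * f z"
      unfolding f_def g_def using scf_cone_cross[OF assms(1) yz(1)] scf_cone_cross[OF assms(2) yz(1)]
      by auto
    have "scf_coord z \<le> scf_coord y" using yz by (intro scf_coord_mono) auto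
    then have "exp \<bar>scf_coord y - scf_coord z\<bar> = exp (scf_coord y) / exp (scf_coord z)"
      by (simp add: exp_diff)
    also have "\<dots> = (g y / f y) / (g z / f z)"
      unfolding scf_coord_def f_def[symmetric] g_def[symmetric] using pos by simp
    finally have r: "exp \<bar>scf_coord y - scf_coord z\<bar> = (g y * f z) / (f y * g z)" using pos by simp
    have "(A z * f y) * (B z * f y) \<le> (A y * f z) * (B y * f z)"
      using mult_mono[OF c(2) c(4)] pos by simp
    then have "(g y * g z) * ((A z * f y) * (B z * f y)) \<le> (g y * g z) * ((A y * f z) * (B y * f z))"
      using pos by (intro mult_left_mono) auto
    then show "Q y \<le> exp \<bar>scf_coord y - scf_coord z\<bar> * Q z"
      unfolding Q_def r W using pos by (simp add: divide_simps mult_ac)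
    have "(A y * g z) * (B y * g z) \<le> (A z * g y) * (B z * g y)"
      using mult_mono[OF c(1) c(3)] pos by simp
    then have "(f y * f z) * ((A y * g z) * (B y * g z)) \<le> (f y * f z) * ((A z * g y) * (B z * g y))"
      using pos by (intro mult_left_mono) auto
    then show "Q z \<le> exp \<bar>scf_coord y - scf_coord z\<bar> * Q y"
      unfolding Q_def r W using pos by (simp add: divide_simps mult_ac)
    show "0 \<le> Q y + Q z" unfolding Q_def W using pos by (intro add_nonneg_nonneg) auto
  qed simp
  show ?thesis using *[of z y] *[of y z] assms(3,4)
    by (cases "z \<le> y") (auto simp: abs_minus_commute add.commute)
qed

section \<open>Inverse branches and branch probabilities\<close>

text \<open>Makes products of \<open>sqrt 3\<close> with a symbol index accessible to linear
  arithmetic; \<open>c\<close> will be the smallest admissible index.\<close>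

lemma sqrt_3_mult_ge:
  assumes "c \<le> x"
  shows "173/100 * x + c * sqrt 3 \<le> 173/100 * c + x * sqrt 3"
    "1733/1000 * c + x * sqrt 3 \<le> 1733/1000 * x + c * sqrt 3"
proof -
  have "0 \<le> (x - c) * (sqrt 3 - 173/100)" "0 \<le> (x - c) * (1733/1000 - sqrt 3)"
    using assms sqrt_3_bounds by auto
  then show "173/100 * x + c * sqrt 3 \<le> 173/100 * c + x * sqrt 3"
    "1733/1000 * c + x * sqrt 3 \<le> 1733/1000 * x + c * sqrt 3"
    by (simp_all add: field_simps)
qed

text \<open>Numerator and denominator of the inverse branch, a Moebius map of determinant
  \<open>- \<epsilon>\<close>. They are kept apart because each factor of \<open>scf_weight\<close>
  at the image point becomes affine once multiplied by \<open>scf_den\<close>.\<close>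

fun scf_num :: "scf_symbol \<Rightarrow> real \<Rightarrow> real" where
  "scf_num (k, \<epsilon>, Par_e) y = 1"
| "scf_num (k, \<epsilon>, Par_o) y =
     (if \<epsilon> = 1 then real k + (real k - 1) * y else (real k - 1) + real k * y)"

fun scf_den :: "scf_symbol \<Rightarrow> real \<Rightarrow> real" where
  "scf_den (k, \<epsilon>, Par_e) y = (if \<epsilon> = 1 then 2 * real k + y else 2 * real k - y)"
| "scf_den (k, \<epsilon>, Par_o) y =
     (if \<epsilon> = 1 then (real k + 1) + real k * y else real k + (real k + 1) * y)"

definition scf_inv :: "scf_symbol \<Rightarrow> real \<Rightarrow> real" where
  "scf_inv \<omega> y = scf_num \<omega> y / scf_den \<omega> y"

text \<open>With \<open>h = 1 / scf_weight\<close> and \<open>\<phi> = scf_inv \<omega>\<close> this is \<open>\<bar>\<phi>'\<bar> (h \<circ> \<phi>) / h\<close>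
  (lemma \<open>scf_inv_deriv_weight\<close>), the probability that a stationary orbit at \<open>y\<close> came through
  the branch \<open>\<omega>\<close>.\<close>

definition scf_prob :: "scf_symbol \<Rightarrow> real \<Rightarrow> real" where
  "scf_prob \<omega> y = scf_weight y /
     ((scf_den \<omega> y - (2 - sqrt 3) * scf_num \<omega> y) * (scf_den \<omega> y + sqrt 3 * scf_num \<omega> y))"

lemma scf_alphabet_cases:
  assumes "\<omega> \<in> scf_alphabet"
  obtains k where "1 \<le> k" "\<omega> = (k, 1, Par_e)"
  | k where "2 \<le> k" "\<omega> = (k, -1, Par_e)"
  | k where "2 \<le> k" "\<omega> = (k, 1, Par_o)"
  | k where "2 \<le> k" "\<omega> = (k, -1, Par_o)"
proof -
  obtain k \<epsilon> s where w: "\<omega> = (k, \<epsilon>, s)" by (cases \<omega>)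
  with assms have "1 \<le> k \<and> \<epsilon> = 1 \<and> s = Par_e \<or> 2 \<le> k \<and> \<epsilon> = -1 \<and> s = Par_e \<or>
    2 \<le> k \<and> \<epsilon> = 1 \<and> s = Par_o \<or> 2 \<le> k \<and> \<epsilon> = -1 \<and> s = Par_o"
    by (cases s) (auto simp: scf_alphabet_def)
  then show ?thesis using that w by blast
qed

lemma scf_den_pos:
  assumes "\<omega> \<in> scf_alphabet" "0 \<le> y" "y \<le> 1" shows "0 < scf_den \<omega> y"
  using assms(1) by (cases rule: scf_alphabet_cases) (use assms(2,3) in \<open>auto simp: add_pos_nonneg\<close>)

lemma scf_num_bounds:
  assumes "\<omega> \<in> scf_alphabet" "0 \<le> y" "y \<le> 1"
  shows "0 < scf_num \<omega> y" "scf_num \<omega> y < scf_den \<omega> y"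
proof -
  show "0 < scf_num \<omega> y"
    using assms(1) by (cases rule: scf_alphabet_cases) (use assms(2,3) in \<open>auto simp: add_pos_nonneg\<close>)
  show "scf_num \<omega> y < scf_den \<omega> y"
    using assms(1) by (cases rule: scf_alphabet_cases) (use assms(2,3) in \<open>auto simp: algebra_simps\<close>)
qed

lemma scf_inv_mem:
  assumes "\<omega> \<in> scf_alphabet" "y \<in> {0..1}" shows "scf_inv \<omega> y \<in> {0..1}"
  using assms scf_den_pos[of \<omega> y] scf_num_bounds[of \<omega> y] unfolding scf_inv_def by auto

text \<open>This affine function and the one in \<open>scf_cone_plus\<close> are
  \<open>scf_den\<close> times the two factors of the weight at \<open>scf_inv \<omega> y\<close>.
  Their membership in the cone makes \<open>scf_prob\<close> an instance of
  \<open>scf_cone_quotient\<close>.\<close>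

lemma scf_cone_minus:
  assumes "\<omega> \<in> scf_alphabet" shows "scf_cone (\<lambda>y. scf_den \<omega> y - (2 - sqrt 3) * scf_num \<omega> y)"
  using assms
proof (cases rule: scf_alphabet_cases)
  case (1 k)
  then show ?thesis using sqrt_3_bounds sqrt_3_mult_ge[of 1 "real k"]
    by (intro scf_coneI[of "2 * real k - (2 - sqrt 3)" 1]) (auto simp: algebra_simps)
next
  case (2 k)
  then show ?thesis using 2 sqrt_3_bounds sqrt_3_mult_ge[of 2 "real k"]
    by (intro scf_coneI[of "2 * real k - (2 - sqrt 3)" "-1"]) (auto simp: algebra_simps)
next
  case (3 k)
  show ?thesis using 3 sqrt_3_bounds sqrt_3_mult_ge[of 2 "real k"]
    by (intro scf_coneI[of "(sqrt 3 - 1) * real k + 1" "(sqrt 3 - 1) * real k + (2 - sqrt 3)"])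
      (auto simp: algebra_simps)
next
  case (4 k)
  show ?thesis using 4 sqrt_3_bounds sqrt_3_mult_ge[of 2 "real k"]
    by (intro scf_coneI[of "(sqrt 3 - 1) * real k + (2 - sqrt 3)" "(sqrt 3 - 1) * real k + 1"])
      (auto simp: algebra_simps)
qed

lemma scf_cone_plus:
  assumes "\<omega> \<in> scf_alphabet" shows "scf_cone (\<lambda>y. scf_den \<omega> y + sqrt 3 * scf_num \<omega> y)"
  using assms
proof (cases rule: scf_alphabet_cases)
  case (1 k)
  then show ?thesis using sqrt_3_bounds sqrt_3_mult_ge[of 1 "real k"]
    by (intro scf_coneI[of "2 * real k + sqrt 3" 1]) (auto simp: algebra_simps)
next
  case (2 k)
  then show ?thesis using 2 sqrt_3_bounds sqrt_3_mult_ge[of 2 "real k"]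
    by (intro scf_coneI[of "2 * real k + sqrt 3" "-1"]) (auto simp: algebra_simps)
next
  case (3 k)
  show ?thesis using 3 sqrt_3_bounds sqrt_3_mult_ge[of 2 "real k"]
    by (intro scf_coneI[of "(sqrt 3 + 1) * real k + 1" "(sqrt 3 + 1) * real k - sqrt 3"])
      (auto simp: algebra_simps)
next
  case (4 k)
  show ?thesis using 4 sqrt_3_bounds sqrt_3_mult_ge[of 2 "real k"]
    by (intro scf_coneI[of "(sqrt 3 + 1) * real k - sqrt 3" "(sqrt 3 + 1) * real k + 1"])
      (auto simp: algebra_simps)
qed

lemma scf_prob_diff:
  assumes "\<omega> \<in> scf_alphabet" "y \<in> {0..1}" "z \<in> {0..1}"
  shows "\<bar>scf_prob \<omega> y - scf_prob \<omega> z\<bar>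
    \<le> \<bar>scf_coord y - scf_coord z\<bar> / 2 * (scf_prob \<omega> y + scf_prob \<omega> z)"
  unfolding scf_prob_def
  by (rule scf_cone_quotient[OF scf_cone_minus[OF assms(1)] scf_cone_plus[OF assms(1)] assms(2,3)])

lemma scf_prob_nonneg:
  assumes "\<omega> \<in> scf_alphabet" "0 \<le> y" "y \<le> 1" shows "0 \<le> scf_prob \<omega> y"
  unfolding scf_prob_def
  using scf_weight_pos[OF assms(2,3)] scf_cone_pos[OF scf_cone_minus[OF assms(1)] assms(2,3)]
    scf_cone_pos[OF scf_cone_plus[OF assms(1)] assms(2,3)] by simp


text \<open>By \<open>scf_inv_deriv_weight\<close> this probability is also the rate at which the
  inverse branch contracts the coordinate. The constant is not sharp; it has to stay below
  \<open>1 - ln (2 + sqrt 3) / 2\<close>, about 0.34.\<close>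

lemma scf_prob_le:
  assumes "\<omega> \<in> scf_alphabet" "0 \<le> y" "y \<le> 1" shows "scf_prob \<omega> y \<le> 1 / 4"
proof -
  let ?A = "scf_den \<omega> y - (2 - sqrt 3) * scf_num \<omega> y"
  let ?B = "scf_den \<omega> y + sqrt 3 * scf_num \<omega> y"
  have G: "0 < scf_weight y" "scf_weight y \<le> 2"
    using scf_weight_pos scf_weight_le_2 assms by auto
  have "4 * scf_weight y \<le> ?A * ?B"
    using assms(1)
  proof (cases rule: scf_alphabet_cases)
    case (1 k)
    \<comment> \<open>Both factors increase with \<open>k\<close>; the left side is their product at
      \<open>k = 1\<close>. What remains is a quadratic inequality in \<open>y\<close>.\<close>
    have "(y + sqrt 3) * (y + 2 + sqrt 3) \<le> ?A * ?B"
      using 1 assms sqrt_3_bounds by (intro mult_mono) (auto simp: algebra_simps)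
    moreover have "(y + sqrt 3) * (y + 2 + sqrt 3) - 4 * scf_weight y
        = (2 * sqrt 3 - 1) + (10 - 6 * sqrt 3) * y + (8 * sqrt 3 - 11) * y\<^sup>2"
      unfolding scf_weight_eq by (simp add: algebra_simps power2_eq_square)
    moreover have "(6 * sqrt 3 - 10) * y \<le> (6 * sqrt 3 - 10) * 1"
      using assms sqrt_3_bounds by (intro mult_left_mono) auto
    moreover have "0 \<le> (8 * sqrt 3 - 11) * y\<^sup>2" using sqrt_3_bounds by simp
    ultimately show ?thesis using sqrt_3_bounds by (simp add: algebra_simps)
  next
    case (2 k)
    have "2 * 4 \<le> ?A * ?B"
      using 2 assms sqrt_3_bounds by (intro mult_mono) (auto simp: algebra_simps)
    then show ?thesis using G by simp
  next
    case (3 k)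
    have k: "(sqrt 3 - 1) * 2 \<le> (sqrt 3 - 1) * real k" "(sqrt 3 + 1) * 2 \<le> (sqrt 3 + 1) * real k"
      by (rule mult_left_mono; use 3 sqrt_3_bounds in simp)+
    have "0 \<le> ((sqrt 3 - 1) * real k + (2 - sqrt 3)) * y" "0 \<le> ((sqrt 3 + 1) * real k - sqrt 3) * y"
      using k assms sqrt_3_bounds by (auto intro!: mult_nonneg_nonneg)
    moreover have "?A = (sqrt 3 - 1) * real k + 1 + ((sqrt 3 - 1) * real k + (2 - sqrt 3)) * y"
      "?B = (sqrt 3 + 1) * real k + 1 + ((sqrt 3 + 1) * real k - sqrt 3) * y"
      using 3 by (simp_all add: algebra_simps)
    ultimately have "(sqrt 3 - 1) * 2 + 1 \<le> ?A" "(sqrt 3 + 1) * 2 + 1 \<le> ?B"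
      using k by (simp_all only:)
    then have "2 \<le> ?A" "4 \<le> ?B" using sqrt_3_bounds by auto
    then have "2 * 4 \<le> ?A * ?B" by (intro mult_mono) simp_all
    then show ?thesis using G by simp
  next
    case (4 k)
    have k: "(sqrt 3 - 1) * 2 \<le> (sqrt 3 - 1) * real k" "(sqrt 3 + 1) * 2 \<le> (sqrt 3 + 1) * real k"
      by (rule mult_left_mono; use 4 sqrt_3_bounds in simp)+
    have "0 \<le> ((sqrt 3 - 1) * real k + 1) * y"
      using k assms sqrt_3_bounds by (auto intro!: mult_nonneg_nonneg)
    moreover have "?A = (sqrt 3 - 1) * real k + (2 - sqrt 3) + ((sqrt 3 - 1) * real k + 1) * y"
      using 4 by (simp_all add: algebra_simps)
    ultimately have "(sqrt 3 - 1) * 2 + (2 - sqrt 3) \<le> ?A" using k by (simp only:)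
    then have A: "sqrt 3 \<le> ?A" by simp
    \<comment> \<open>Constant lower bounds fail here: for \<open>k = 2\<close>,
      \<open>y = 0\<close> the product \<open>?A * ?B\<close> is only
      \<open>sqrt 3 * (2 + sqrt 3)\<close>, less than the 8 reached in cases 2 and 3. So
      \<open>?B\<close> is bounded below by a multiple of \<open>1 + sqrt 3 * y\<close>, which also
      bounds the weight from above.\<close>
    have "((sqrt 3 + 1) * 2 + 1) * y \<le> ((sqrt 3 + 1) * real k + 1) * y"
      using k assms by (intro mult_right_mono) auto
    then have "((sqrt 3 + 1) * 2 - sqrt 3) + ((sqrt 3 + 1) * 2 + 1) * y
      \<le> ((sqrt 3 + 1) * real k - sqrt 3) + ((sqrt 3 + 1) * real k + 1) * y"
      by (intro add_mono diff_right_mono k(2))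
    moreover have "?B = ((sqrt 3 + 1) * real k - sqrt 3) + ((sqrt 3 + 1) * real k + 1) * y"
      using 4 by (simp_all add: algebra_simps)
    moreover have "(2 + sqrt 3) * (1 + sqrt 3 * y)
      = ((sqrt 3 + 1) * 2 - sqrt 3) + ((sqrt 3 + 1) * 2 + 1) * y"
      by (simp add: algebra_simps)
    ultimately have B: "(2 + sqrt 3) * (1 + sqrt 3 * y) \<le> ?B" by (simp only:)
    have "(1 - (2 - sqrt 3) * y) * (1 + sqrt 3 * y) \<le> 1 * (1 + sqrt 3 * y)"
      using assms sqrt_3_bounds by (intro mult_right_mono) auto
    then have W: "scf_weight y \<le> 1 + sqrt 3 * y" unfolding scf_weight_def by simp
    have "4 * scf_weight y \<le> (2 * sqrt 3 + 3) * (1 + sqrt 3 * y)"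
      using W G sqrt_3_bounds by (intro mult_mono) auto
    also have "\<dots> = sqrt 3 * ((2 + sqrt 3) * (1 + sqrt 3 * y))" by (simp add: algebra_simps)
    also have "\<dots> \<le> ?A * ?B"
      by (rule mult_mono[OF A B order_trans[OF _ A]]) (use assms in auto)
    finally show ?thesis .
  qed
  moreover from this G have "0 < ?A * ?B" by linarith
  ultimately show ?thesis unfolding scf_prob_def by (simp add: divide_simps)
qed

definition scf_inv_deriv :: "scf_symbol \<Rightarrow> real \<Rightarrow> real" where
  "scf_inv_deriv \<omega> y = - of_int (fst (snd \<omega>)) / (scf_den \<omega> y)\<^sup>2"

lemma scf_inv_has_deriv:
  assumes "\<omega> \<in> scf_alphabet" "0 \<le> y" "y \<le> 1"
  shows "(scf_inv \<omega> has_real_derivative scf_inv_deriv \<omega> y) (at y within X)"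
proof -
  have d: "scf_den \<omega> y \<noteq> 0" using scf_den_pos[OF assms] by simp
  show ?thesis
    using assms(1)
  proof (cases rule: scf_alphabet_cases)
    case (1 k)
    with d show ?thesis unfolding scf_inv_def scf_inv_deriv_def
      by (auto intro!: derivative_eq_intros simp: power2_eq_square)
  next
    case (2 k)
    with d show ?thesis unfolding scf_inv_def scf_inv_deriv_def
      by (auto intro!: derivative_eq_intros simp: power2_eq_square)
  next
    case (3 k)
    with d show ?thesis unfolding scf_inv_def scf_inv_deriv_def
      by (auto intro!: derivative_eq_intros simp: power2_eq_square) (simp add: field_simps)
  next
    case (4 k)
    with d show ?thesis unfolding scf_inv_def scf_inv_deriv_def
      by (auto intro!: derivative_eq_intros simp: power2_eq_square) (simp add: field_simps)
  qed
qed

lemma scf_inv_deriv_weight: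
  assumes "\<omega> \<in> scf_alphabet" "0 \<le> y" "y \<le> 1"
  shows "\<bar>scf_inv_deriv \<omega> y\<bar> / scf_weight (scf_inv \<omega> y) = scf_prob \<omega> y / scf_weight y"
proof -
  have d: "scf_den \<omega> y \<noteq> 0" using scf_den_pos[OF assms] by simp
  have "\<bar>scf_inv_deriv \<omega> y\<bar> = 1 / (scf_den \<omega> y)\<^sup>2"
    using assms(1) by (cases rule: scf_alphabet_cases) (auto simp: scf_inv_deriv_def)
  moreover have "scf_weight (scf_inv \<omega> y) =
    (scf_den \<omega> y - (2 - sqrt 3) * scf_num \<omega> y) * (scf_den \<omega> y + sqrt 3 * scf_num \<omega> y) / (scf_den \<omega> y)\<^sup>2"
    unfolding scf_weight_def scf_inv_def using d by (simp add: field_simps power2_eq_square)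
  ultimately show ?thesis
    unfolding scf_prob_def using d scf_weight_pos[OF assms(2,3)] by simp
qed

text \<open>With respect to the coordinate, the inverse branch has a derivative of absolute value
  \<open>scf_prob \<omega>\<close>, at most \<open>1/4\<close>.\<close>

lemma scf_inv_contraction:
  assumes "\<omega> \<in> scf_alphabet" "y \<in> {0..1}" "z \<in> {0..1}"
  shows "\<bar>scf_coord (scf_inv \<omega> y) - scf_coord (scf_inv \<omega> z)\<bar> \<le> 1 / 4 * \<bar>scf_coord y - scf_coord z\<bar>"
proof -
  have *: "\<bar>scf_coord (scf_inv \<omega> y) - scf_coord (scf_inv \<omega> z)\<bar> \<le> 1 / 4 * \<bar>scf_coord y - scf_coord z\<bar>"
    if yz: "z \<le> y" "0 \<le> z" "y \<le> 1" for y z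
  proof -
    \<comment> \<open>Taking \<open>s = 1\<close> and \<open>s = -1\<close> gives both halves of the
      bound, whatever the orientation of the branch.\<close>
    have mono: "1 / 4 * scf_coord z + s * scf_coord (scf_inv \<omega> z)
        \<le> 1 / 4 * scf_coord y + s * scf_coord (scf_inv \<omega> y)" if s: "\<bar>s\<bar> = 1" for s :: real
    proof (rule deriv_nonneg_imp_mono[of z y "\<lambda>t. 1 / 4 * scf_coord t + s * scf_coord (scf_inv \<omega> t)"
          "\<lambda>t. 1 / 4 * (2 / scf_weight t) + s * (2 / scf_weight (scf_inv \<omega> t) * scf_inv_deriv \<omega> t)"])
      fix t assume "t \<in> {z..y}"
      then have t: "0 \<le> t" "t \<le> 1" using yz by auto
      then have it: "0 \<le> scf_inv \<omega> t" "scf_inv \<omega> t \<le> 1" using scf_inv_mem[OF assms(1), of t] by auto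
      show "((\<lambda>t. 1 / 4 * scf_coord t + s * scf_coord (scf_inv \<omega> t)) has_real_derivative
          1 / 4 * (2 / scf_weight t) + s * (2 / scf_weight (scf_inv \<omega> t) * scf_inv_deriv \<omega> t)) (at t)"
        by (intro DERIV_add DERIV_cmult DERIV_chain2[of scf_coord] scf_coord_deriv t it
            scf_inv_has_deriv assms(1))
      have "\<bar>s * (2 / scf_weight (scf_inv \<omega> t) * scf_inv_deriv \<omega> t)\<bar>
          = 2 * (\<bar>scf_inv_deriv \<omega> t\<bar> / scf_weight (scf_inv \<omega> t))"
        using s scf_weight_pos[OF it] by (simp add: abs_mult)
      also have "\<dots> = 2 * (scf_prob \<omega> t / scf_weight t)"
        unfolding scf_inv_deriv_weight[OF assms(1) t] ..
      also have "\<dots> \<le> 2 * ((1 / 4) / scf_weight t)"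
        using scf_prob_le[OF assms(1) t] scf_weight_pos[OF t]
        by (intro mult_left_mono divide_right_mono) auto
      also have "\<dots> = 1 / 4 * (2 / scf_weight t)" by simp
      finally have le: "\<bar>s * (2 / scf_weight (scf_inv \<omega> t) * scf_inv_deriv \<omega> t)\<bar>
          \<le> 1 / 4 * (2 / scf_weight t)" .
      have "0 \<le> v + u" if "\<bar>u\<bar> \<le> v" for u v :: real using that by linarith
      from this[OF le] show "0 \<le> 1 / 4 * (2 / scf_weight t)
          + s * (2 / scf_weight (scf_inv \<omega> t) * scf_inv_deriv \<omega> t)" .
    qed (use yz in auto)
    have "scf_coord z \<le> scf_coord y" using scf_coord_mono yz by auto
    moreover have "\<bar>scf_coord (scf_inv \<omega> y) - scf_coord (scf_inv \<omega> z)\<bar> \<le> 1 / 4 * (scf_coord y - scf_coord z)"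
      unfolding abs_le_iff using mono[of 1] mono[of "-1"] by (simp add: algebra_simps)
    ultimately show ?thesis by simp
  qed
  show ?thesis using *[of y z] *[of z y] assms
    by (cases "z \<le> y") (auto simp: abs_minus_commute)
qed

section \<open>The tail of the branch probabilities\<close>

definition scf_symbols_upto :: "nat \<Rightarrow> scf_symbol set" where
  "scf_symbols_upto M = {\<omega> \<in> scf_alphabet. fst \<omega> \<le> M}"

text \<open>\<open>1 \<le> M\<close> excludes the step to index 1, which carries one symbol instead
  of four.\<close>

lemma scf_symbols_upto_Suc:
  assumes "1 \<le> M"
  shows "scf_symbols_upto (Suc M) = scf_symbols_upto M \<union>
    {(Suc M, 1, Par_e), (Suc M, -1, Par_e), (Suc M, 1, Par_o), (Suc M, -1, Par_o)}"
proof -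
  have "(k, \<epsilon>, s) \<in> scf_symbols_upto (Suc M) \<longleftrightarrow> (k, \<epsilon>, s) \<in> scf_symbols_upto M \<union>
    {(Suc M, 1, Par_e), (Suc M, -1, Par_e), (Suc M, 1, Par_o), (Suc M, -1, Par_o)}" for k \<epsilon> s
    using assms by (cases s) (auto simp: scf_symbols_upto_def scf_alphabet_def le_Suc_eq)
  then show ?thesis by auto
qed

lemma scf_symbols_upto_1: "scf_symbols_upto 1 = {(1, 1, Par_e)}"
  by (auto simp: scf_symbols_upto_def scf_alphabet_def)

lemma finite_scf_symbols_upto: "finite (scf_symbols_upto M)"
proof (cases "M = 0")
  case True
  then have "scf_symbols_upto M = {}" by (auto simp: scf_symbols_upto_def scf_alphabet_def)
  then show ?thesis by simp
next
  case False
  then have "1 \<le> M" by simp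
  then show ?thesis
    by (induction M rule: nat_induct_at_least)
      (simp_all only: scf_symbols_upto_1 scf_symbols_upto_Suc finite_Un finite_insert finite.emptyI)
qed

text \<open>The denominators that make the sums of \<open>scf_prob\<close> over the odd symbols telescope.\<close>
definition scf_odd_minus :: "nat \<Rightarrow> real \<Rightarrow> real" where
  "scf_odd_minus k y = (sqrt 3 - 1) * real k + (2 - sqrt 3) + ((sqrt 3 - 1) * real k + 1) * y"

definition scf_odd_plus :: "nat \<Rightarrow> real \<Rightarrow> real" where
  "scf_odd_plus k y = (sqrt 3 - 1) * real k + 1 + ((sqrt 3 - 1) * real k + (2 - sqrt 3)) * y"

text \<open>The total probability of the symbols with integer part above \<open>M\<close>, in closed form.\<close>

definition scf_tail :: "nat \<Rightarrow> real \<Rightarrow> real" where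
  "scf_tail M y =
     (scf_weight y / (2 * real M + sqrt 3 + y) + scf_weight y / (2 * real M + sqrt 3 - y)) / 2 +
     (sqrt 3 - 1) / 2 * (scf_weight y / ((1 + y) * scf_odd_minus M y) +
        scf_weight y / ((1 + y) * scf_odd_plus M y))"

lemma scf_odd_ge:
  assumes "0 \<le> y"
  shows "(sqrt 3 - 1) * real k \<le> scf_odd_minus k y" "(sqrt 3 - 1) * real k \<le> scf_odd_plus k y"
    "0 < scf_odd_minus k y" "0 < scf_odd_plus k y"
proof -
  have k: "0 \<le> (sqrt 3 - 1) * real k" using sqrt_3_bounds by simp
  have "0 \<le> ((sqrt 3 - 1) * real k + 1) * y" "0 \<le> ((sqrt 3 - 1) * real k + (2 - sqrt 3)) * y"
    using assms k sqrt_3_bounds by (auto intro!: mult_nonneg_nonneg)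
  with k show "(sqrt 3 - 1) * real k \<le> scf_odd_minus k y" "(sqrt 3 - 1) * real k \<le> scf_odd_plus k y"
    "0 < scf_odd_minus k y" "0 < scf_odd_plus k y"
    unfolding scf_odd_minus_def scf_odd_plus_def using sqrt_3_bounds by linarith+
qed

text \<open>Partial fractions. For an even symbol the two factors in \<open>scf_prob\<close> differ
  by 2, and the larger one is the smaller one of the next index. For an odd symbol of index
  \<open>k\<close> the first factor is \<open>scf_odd_minus k\<close> or
  \<open>scf_odd_plus k\<close>, and \<open>2 - sqrt 3\<close> times the second is the same function
  at \<open>k - 1\<close>.\<close>

lemma scf_tail_telescope:
  assumes "1 \<le> M" "0 \<le> y" "y \<le> 1"
  shows "scf_tail M y - scf_tail (Suc M) y =
    scf_prob (Suc M, 1, Par_e) y + scf_prob (Suc M, -1, Par_e) y +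
    scf_prob (Suc M, 1, Par_o) y + scf_prob (Suc M, -1, Par_o) y"
proof -
  define w where "w = sqrt 3"
  have ww: "w * w = 3" unfolding w_def by (rule sqrt_3_mult_self)
  have www: "w * (w * t) = 3 * t" for t using ww by (simp add: mult.assoc[symmetric])
  have w: "173/100 < w" "w < 1733/1000" unfolding w_def by (rule sqrt_3_bounds)+
  let ?G = "scf_weight y" and ?k = "real (Suc M)"
  have half: "g / (a * (a + 2)) = (g / a - g / (a + 2)) / 2" if "0 < a" for a g :: real
    using that by (simp add: divide_simps) (simp add: algebra_simps)
  have e1: "scf_prob (Suc M, 1, Par_e) y = (?G / (2 * real M + w + y) - ?G / (2 * ?k + w + y)) / 2"
  proof -
    have "scf_prob (Suc M, 1, Par_e) y = ?G / ((2 * real M + w + y) * ((2 * real M + w + y) + 2))"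
      unfolding scf_prob_def w_def[symmetric] by (simp add: algebra_simps)
    also have "\<dots> = (?G / (2 * real M + w + y) - ?G / (2 * real M + w + y + 2)) / 2"
      by (rule half) (use w assms in auto)
    finally show ?thesis by (simp add: algebra_simps)
  qed
  have e2: "scf_prob (Suc M, -1, Par_e) y = (?G / (2 * real M + w - y) - ?G / (2 * ?k + w - y)) / 2"
  proof -
    have "scf_prob (Suc M, -1, Par_e) y = ?G / ((2 * real M + w - y) * ((2 * real M + w - y) + 2))"
      unfolding scf_prob_def w_def[symmetric] by (simp add: algebra_simps)
    also have "\<dots> = (?G / (2 * real M + w - y) - ?G / (2 * real M + w - y + 2)) / 2"
      by (rule half) (use w assms in auto)
    finally show ?thesis by (simp add: algebra_simps)
  qed
  \<comment> \<open>\<open>b\<close> and \<open>c\<close> are the two factors for index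
    \<open>Suc M\<close>, and \<open>a\<close> is the analogue of \<open>b\<close> for index
    \<open>M\<close>. The constant comes from
    \<open>(w - 1) * (w - 1) = 2 * (2 - w)\<close>.\<close>
  have odd: "g / (b * c) = (w - 1) / 2 * (g / ((1 + y) * a) - g / ((1 + y) * b))"
    if "0 < a" "0 < b" "b = a + (w - 1) * (1 + y)" "a = (2 - w) * c" for a b c g :: real
  proof -
    have c: "0 < c" using that w by (simp add: zero_less_mult_iff)
    have "(w - 1) / 2 * (g / ((1 + y) * a) - g / ((1 + y) * b)) =
      (w - 1) / 2 * (g * (b - a)) / ((1 + y) * (a * b))"
      using that(1,2) assms by (simp add: divide_simps) (simp add: algebra_simps)
    also have "\<dots> = ((w - 1) * (w - 1)) / 2 * g / (a * b)"
      using that(1,2) assms unfolding that(3) by (simp add: divide_simps)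
    also have "(w - 1) * (w - 1) = 4 - 2 * w" by (simp add: algebra_simps ww)
    also have "(4 - 2 * w) / 2 = 2 - w" by simp
    also have "(2 - w) * g / (a * b) = g / (b * c)"
      using c w that(2) unfolding that(4) by (simp add: divide_simps)
    finally show ?thesis by simp
  qed
  have o1: "scf_prob (Suc M, -1, Par_o) y = (w - 1) / 2 *
     (?G / ((1 + y) * scf_odd_minus M y) - ?G / ((1 + y) * scf_odd_minus (Suc M) y))"
  proof -
    have "scf_prob (Suc M, -1, Par_o) y = ?G / (scf_odd_minus (Suc M) y *
      ((w + 1) * ?k - w + ((w + 1) * ?k + 1) * y))"
      unfolding scf_prob_def w_def[symmetric] scf_odd_minus_def by (simp add: algebra_simps)
    also have "\<dots> = (w - 1) / 2 *
     (?G / ((1 + y) * scf_odd_minus M y) - ?G / ((1 + y) * scf_odd_minus (Suc M) y))"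
    proof (rule odd)
      show "scf_odd_minus M y = (2 - w) * ((w + 1) * ?k - w + ((w + 1) * ?k + 1) * y)"
        unfolding scf_odd_minus_def w_def[symmetric] by (simp add: algebra_simps ww www)
      show "scf_odd_minus (Suc M) y = scf_odd_minus M y + (w - 1) * (1 + y)"
        unfolding scf_odd_minus_def w_def[symmetric] by (simp add: algebra_simps)
    qed (use scf_odd_ge assms in auto)
    finally show ?thesis .
  qed
  have o2: "scf_prob (Suc M, 1, Par_o) y = (w - 1) / 2 *
     (?G / ((1 + y) * scf_odd_plus M y) - ?G / ((1 + y) * scf_odd_plus (Suc M) y))"
  proof -
    have "scf_prob (Suc M, 1, Par_o) y = ?G / (scf_odd_plus (Suc M) y *
      ((w + 1) * ?k + 1 + ((w + 1) * ?k - w) * y))"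
      unfolding scf_prob_def w_def[symmetric] scf_odd_plus_def by (simp add: algebra_simps)
    also have "\<dots> = (w - 1) / 2 *
     (?G / ((1 + y) * scf_odd_plus M y) - ?G / ((1 + y) * scf_odd_plus (Suc M) y))"
    proof (rule odd)
      show "scf_odd_plus M y = (2 - w) * ((w + 1) * ?k + 1 + ((w + 1) * ?k - w) * y)"
        unfolding scf_odd_plus_def w_def[symmetric] by (simp add: algebra_simps ww www)
      show "scf_odd_plus (Suc M) y = scf_odd_plus M y + (w - 1) * (1 + y)"
        unfolding scf_odd_plus_def w_def[symmetric] by (simp add: algebra_simps)
    qed (use scf_odd_ge assms in auto)
    finally show ?thesis .
  qed
  show ?thesis
    unfolding e1 e2 o1 o2 scf_tail_def w_def[symmetric] by (simp add: algebra_simps add_divide_distrib diff_divide_distrib)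
qed

text \<open>The branch probabilities add up to 1, which expresses the invariance of the density;
  telescoping has reduced this to one rational identity. It closes because
  \<open>scf_odd_minus 1 y\<close> and \<open>(2 - sqrt 3) * (2 + sqrt 3 - y)\<close> are the two
  factors of the weight.\<close>

lemma scf_tail_1:
  assumes "0 \<le> y" "y \<le> 1"
  shows "scf_tail 1 y + scf_prob (1, 1, Par_e) y = 1"
proof -
  define w where "w = sqrt 3"
  have ww: "w * w = 3" unfolding w_def by (rule sqrt_3_mult_self)
  have www: "w * (w * t) = 3 * t" for t using ww by (simp add: mult.assoc[symmetric])
  have w: "173/100 < w" "w < 1733/1000" unfolding w_def by (rule sqrt_3_bounds)+
  let ?G = "scf_weight y"
  have f: "0 < 1 - (2 - w) * y" "0 < 1 + w * y"
    unfolding w_def using scf_factors_pos[OF assms] by auto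
  have G: "?G = (1 - (2 - w) * y) * (1 + w * y)" unfolding scf_weight_def w_def by simp
  have p: "0 < w + y" "0 < 2 + w - y" "0 < 1 + y" using w assms by auto
  have m: "scf_odd_minus 1 y = 1 + w * y" "scf_odd_plus 1 y = w + y"
    unfolding scf_odd_minus_def scf_odd_plus_def w_def by (simp_all add: algebra_simps)
  have 1: "scf_prob (1, 1, Par_e) y = (?G / (w + y) - ?G / (2 + w + y)) / 2"
    unfolding scf_prob_def w_def[symmetric] using p(1) assms w
    by (simp add: divide_simps) (simp add: algebra_simps)
  have "(2 - w) * (2 + w - y) = 1 - (2 - w) * y" using ww by (simp add: algebra_simps)
  then have 2: "?G / (2 + w - y) = (2 - w) * (1 + w * y)"
    unfolding G using p by (simp add: divide_simps mult_ac)
  have 3: "(w - 1) / 2 * (?G / ((1 + y) * (1 + w * y)) + ?G / ((1 + y) * (w + y)))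
     = (1 - (2 - w) * y) / (w + y)"
  proof -
    have "?G / ((1 + y) * (1 + w * y)) + ?G / ((1 + y) * (w + y))
      = (1 - (2 - w) * y) * ((w + y) + (1 + w * y)) / ((1 + y) * (w + y))"
      unfolding G using f p by (simp add: divide_simps) (simp add: algebra_simps)
    also have "(w + y) + (1 + w * y) = (w + 1) * (1 + y)" by (simp add: algebra_simps)
    also have "(1 - (2 - w) * y) * ((w + 1) * (1 + y)) / ((1 + y) * (w + y))
      = (w + 1) * ((1 - (2 - w) * y) / (w + y))" using p by (simp add: divide_simps)
    also have "(w - 1) / 2 * ((w + 1) * x) = x" for x
    proof -
      have "(w - 1) / 2 * ((w + 1) * x) = (w * w - 1) / 2 * x" by (simp add: field_simps)
      then show ?thesis unfolding ww by simp
    qed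
    finally show ?thesis .
  qed
  have "scf_tail 1 y + scf_prob (1, 1, Par_e) y =
     (?G / (w + y) + (2 - w) * (1 + w * y)) / 2 + (1 - (2 - w) * y) / (w + y)"
  proof -
    have "scf_tail 1 y = (?G / (2 + w + y) + ?G / (2 + w - y)) / 2 +
      (w - 1) / 2 * (?G / ((1 + y) * (1 + w * y)) + ?G / ((1 + y) * (w + y)))"
      unfolding scf_tail_def m w_def[symmetric] by simp
    then show ?thesis unfolding 1 2 3 by (simp add: add_divide_distrib diff_divide_distrib)
  qed
  also have "\<dots> = (?G + (2 - w) * (1 + w * y) * (w + y) + 2 * (1 - (2 - w) * y)) / (2 * (w + y))"
  proof -
    have "(g / s + c) / 2 + e / s = (g + c * s + 2 * e) / (2 * s)" if "0 < s" for g s c e :: real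
      using that by (simp add: field_simps)
    then show ?thesis using p(1) by blast
  qed
  also have "?G + (2 - w) * (1 + w * y) * (w + y) + 2 * (1 - (2 - w) * y) = 2 * (w + y)"
    unfolding G by (simp add: algebra_simps ww www)
  finally show ?thesis using p by simp
qed

lemma scf_prob_sum:
  assumes "1 \<le> M" "0 \<le> y" "y \<le> 1"
  shows "(\<Sum>\<omega>\<in>scf_symbols_upto M. scf_prob \<omega> y) = 1 - scf_tail M y"
  using assms(1)
proof (induction M rule: nat_induct_at_least)
  case base
  then show ?case using scf_tail_1[OF assms(2,3)] by (simp add: scf_symbols_upto_1 del: One_nat_def)
next
  case (Suc M)
  have "(\<Sum>\<omega>\<in>scf_symbols_upto (Suc M). scf_prob \<omega> y) = (\<Sum>\<omega>\<in>scf_symbols_upto M. scf_prob \<omega> y) +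
     (\<Sum>\<omega>\<in>{(Suc M, 1, Par_e), (Suc M, -1, Par_e), (Suc M, 1, Par_o), (Suc M, -1, Par_o)}. scf_prob \<omega> y)"
    unfolding scf_symbols_upto_Suc[OF Suc.hyps]
    by (intro sum.union_disjoint finite_scf_symbols_upto) (auto simp: scf_symbols_upto_def)
  then show ?case using Suc.IH scf_tail_telescope[OF Suc.hyps assms(2,3)] by simp
qed

text \<open>The even symbols contribute at most \<open>1/M\<close> and the odd ones at most
  \<open>2/M\<close>.\<close>

lemma scf_tail_bounds:
  assumes "1 \<le> M" "0 \<le> y" "y \<le> 1"
  shows "0 \<le> scf_tail M y" "scf_tail M y \<le> 3 / real M"
proof -
  have M: "0 < real M" using assms by simp
  have G: "0 < scf_weight y" "scf_weight y \<le> 2"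
    using scf_weight_pos scf_weight_le_2 assms by auto
  have m: "0 < (sqrt 3 - 1) * real M" using sqrt_3_bounds M by simp
  note o = scf_odd_ge[OF assms(2), of M]
  have p: "0 < 2 * real M + sqrt 3 + y" "0 < 2 * real M + sqrt 3 - y"
    using assms sqrt_3_bounds by (auto intro!: add_pos_nonneg)
  show "0 \<le> scf_tail M y"
    unfolding scf_tail_def using p o G assms sqrt_3_bounds
    by (intro add_nonneg_nonneg mult_nonneg_nonneg divide_nonneg_nonneg) auto
  have 1: "scf_weight y / (2 * real M + sqrt 3 + y) \<le> 2 / (2 * real M)"
    "scf_weight y / (2 * real M + sqrt 3 - y) \<le> 2 / (2 * real M)"
    by (rule frac_le; use G assms M sqrt_3_bounds in simp)+
  have 2: "scf_weight y / ((1 + y) * s) \<le> 2 / ((sqrt 3 - 1) * real M)"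
    if "(sqrt 3 - 1) * real M \<le> s" for s
  proof (rule frac_le)
    have "1 * ((sqrt 3 - 1) * real M) \<le> (1 + y) * s" using that m assms by (intro mult_mono) auto
    then show "(sqrt 3 - 1) * real M \<le> (1 + y) * s" by simp
  qed (use G m in auto)
  have "scf_tail M y \<le> (2 / (2 * real M) + 2 / (2 * real M)) / 2 +
     (sqrt 3 - 1) / 2 * (2 / ((sqrt 3 - 1) * real M) + 2 / ((sqrt 3 - 1) * real M))"
    unfolding scf_tail_def using 1 2[OF o(1)] 2[OF o(2)] sqrt_3_bounds
    by (intro add_mono mult_left_mono divide_right_mono) auto
  also have "\<dots> = 3 / real M" using sqrt_3_bounds M by (simp add: field_simps)
  finally show "scf_tail M y \<le> 3 / real M" .
qed

text \<open>Each summand of the closed form is the weight divided by two cone functions (one of them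
  the constant 1 in the even part), so \<open>scf_cone_quotient\<close> applies to it; positive
  combinations preserve the bound.\<close>

lemma scf_tail_diff:
  assumes "1 \<le> M" "y \<in> {0..1}" "z \<in> {0..1}"
  shows "\<bar>scf_tail M y - scf_tail M z\<bar>
    \<le> \<bar>scf_coord y - scf_coord z\<bar> / 2 * (scf_tail M y + scf_tail M z)"
proof -
  define d where "d = \<bar>scf_coord y - scf_coord z\<bar> / 2"
  define f1 f2 f3 f4 where
    "f1 y = scf_weight y / (2 * real M + sqrt 3 + y)" and
    "f2 y = scf_weight y / (2 * real M + sqrt 3 - y)" and
    "f3 y = scf_weight y / ((1 + y) * scf_odd_minus M y)" and
    "f4 y = scf_weight y / ((1 + y) * scf_odd_plus M y)" for y
  have T: "scf_tail M y = (f1 y + f2 y) / 2 + (sqrt 3 - 1) / 2 * (f3 y + f4 y)" for y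
    unfolding scf_tail_def f1_def f2_def f3_def f4_def by simp
  have M: "1 \<le> real M" using assms by simp
  note m = sqrt_3_mult_ge[OF M]
  have c1: "scf_cone (\<lambda>y. 1)" using sqrt_3_bounds by (intro scf_coneI[of 1 0]) auto
  have c2: "scf_cone (\<lambda>y. 1 + y)" using sqrt_3_bounds by (intro scf_coneI[of 1 1]) auto
  have c3: "scf_cone (\<lambda>y. 2 * real M + sqrt 3 + y)" using sqrt_3_bounds m M
    by (intro scf_coneI[of "2 * real M + sqrt 3" 1]) (auto simp: algebra_simps)
  have c4: "scf_cone (\<lambda>y. 2 * real M + sqrt 3 - y)" using sqrt_3_bounds m M
    by (intro scf_coneI[of "2 * real M + sqrt 3" "-1"]) (auto simp: algebra_simps)
  have c5: "scf_cone (scf_odd_minus M)" using sqrt_3_bounds m M unfolding scf_odd_minus_def[abs_def]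
    by (intro scf_coneI[of "(sqrt 3 - 1) * real M + (2 - sqrt 3)" "(sqrt 3 - 1) * real M + 1"])
     (auto simp: algebra_simps)
  have c6: "scf_cone (scf_odd_plus M)" using sqrt_3_bounds m M unfolding scf_odd_plus_def[abs_def]
    by (intro scf_coneI[of "(sqrt 3 - 1) * real M + 1" "(sqrt 3 - 1) * real M + (2 - sqrt 3)"])
     (auto simp: algebra_simps)
  have 1: "\<bar>f1 y - f1 z\<bar> \<le> d * (f1 y + f1 z)"
    using scf_cone_quotient[OF c3 c1 assms(2,3)] unfolding d_def f1_def by simp
  have 2: "\<bar>f2 y - f2 z\<bar> \<le> d * (f2 y + f2 z)"
    using scf_cone_quotient[OF c4 c1 assms(2,3)] unfolding d_def f2_def by simp
  have 3: "\<bar>f3 y - f3 z\<bar> \<le> d * (f3 y + f3 z)"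
    using scf_cone_quotient[OF c2 c5 assms(2,3)] unfolding d_def f3_def by simp
  have 4: "\<bar>f4 y - f4 z\<bar> \<le> d * (f4 y + f4 z)"
    using scf_cone_quotient[OF c2 c6 assms(2,3)] unfolding d_def f4_def by simp
  have "\<bar>(f3 y + f4 y) - (f3 z + f4 z)\<bar> \<le> d * (f3 y + f4 y + f3 z + f4 z)"
    using 3 4 by (simp add: algebra_simps)
  then have "(sqrt 3 - 1) / 2 * \<bar>(f3 y + f4 y) - (f3 z + f4 z)\<bar>
    \<le> (sqrt 3 - 1) / 2 * (d * (f3 y + f4 y + f3 z + f4 z))"
    using sqrt_3_bounds by (intro mult_left_mono) auto
  moreover have "(sqrt 3 - 1) / 2 * \<bar>(f3 y + f4 y) - (f3 z + f4 z)\<bar> =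
     \<bar>(sqrt 3 - 1) / 2 * (f3 y + f4 y) - (sqrt 3 - 1) / 2 * (f3 z + f4 z)\<bar>"
  proof -
    have "c * \<bar>a - b\<bar> = \<bar>c * a - c * b\<bar>" if "0 \<le> c" for a b c :: real
      using that by (simp add: abs_mult flip: right_diff_distrib)
    show ?thesis by (rule \<open>\<And>c b a. 0 \<le> c \<Longrightarrow> c * \<bar>a - b\<bar> = \<bar>c * a - c * b\<bar>\<close>) (use sqrt_3_bounds in simp)
  qed
  moreover have "\<bar>(f1 y + f2 y) / 2 - (f1 z + f2 z) / 2\<bar> \<le> d * ((f1 y + f2 y) / 2 + (f1 z + f2 z) / 2)"
  proof -
    have "d * ((f1 y + f2 y) / 2 + (f1 z + f2 z) / 2) = (d * (f1 y + f1 z) + d * (f2 y + f2 z)) / 2"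
      by (simp add: field_simps)
    moreover have "\<bar>(p + q) / 2 - (p' + q') / 2\<bar> \<le> (u + v) / 2"
      if "\<bar>p - p'\<bar> \<le> u" "\<bar>q - q'\<bar> \<le> v" for p q p' q' u v :: real
      using that unfolding abs_le_iff by (simp add: field_simps)
    ultimately show ?thesis using 1 2 by (simp only:)
  qed
  ultimately have "\<bar>scf_tail M y - scf_tail M z\<bar> \<le>
     d * ((f1 y + f2 y) / 2 + (f1 z + f2 z) / 2) +
     (sqrt 3 - 1) / 2 * (d * (f3 y + f4 y + f3 z + f4 z))" unfolding T by linarith
  also have "\<dots> = d * (scf_tail M y + scf_tail M z)" unfolding T by (simp add: field_simps)
  finally show ?thesis unfolding d_def .
qed

section \<open>Contraction of the restricted transfer operator\<close>

definition scf_lip :: "real \<Rightarrow> (real \<Rightarrow> real) \<Rightarrow> bool" where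
  "scf_lip l f \<longleftrightarrow> (\<forall>y\<in>{0..1}. f y \<in> {0..1}) \<and>
     (\<forall>y\<in>{0..1}. \<forall>z\<in>{0..1}. \<bar>f y - f z\<bar> \<le> l * \<bar>scf_coord y - scf_coord z\<bar>)"

text \<open>The transfer operator normalised by the invariant density and restricted to digits at most \<open>M\<close>.\<close>

definition scf_op :: "nat \<Rightarrow> (real \<Rightarrow> real) \<Rightarrow> real \<Rightarrow> real" where
  "scf_op M f y = (\<Sum>\<omega>\<in>scf_symbols_upto M. scf_prob \<omega> y * f (scf_inv \<omega> y))"

lemma scf_symbols_uptoD: "\<omega> \<in> scf_symbols_upto M \<Longrightarrow> \<omega> \<in> scf_alphabet"
  by (simp add: scf_symbols_upto_def)

lemma continuous_on_scf_coord: "continuous_on {0..1} scf_coord"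
  by (rule DERIV_continuous_on[OF scf_coord_deriv]) auto

lemma scf_coord_midpoint:
  obtains c where "c \<in> {0..1}" "\<And>x. x \<in> {0..1} \<Longrightarrow> \<bar>scf_coord x - scf_coord c\<bar> \<le> ln (2 + sqrt 3) / 2"
proof -
  have "\<exists>c. 0 \<le> c \<and> c \<le> 1 \<and> scf_coord c = ln (2 + sqrt 3) / 2"
    by (rule IVT') (use continuous_on_scf_coord ln_2_sqrt_3 in \<open>auto simp: scf_coord_0 scf_coord_1\<close>)
  then obtain c where c: "0 \<le> c" "c \<le> 1" "scf_coord c = ln (2 + sqrt 3) / 2" by blast
  show thesis
  proof
    show "c \<in> {0..1}" using c by simp
    fix x :: real assume "x \<in> {0..1}"
    then show "\<bar>scf_coord x - scf_coord c\<bar> \<le> ln (2 + sqrt 3) / 2"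
      using scf_coord_mono[of 0 x] scf_coord_mono[of x 1] scf_coord_0 scf_coord_1 c(3)
      unfolding c(3) abs_le_iff by (auto simp: field_simps)
  qed
qed

text \<open>The difference at \<open>y\<close> and \<open>z\<close> is split in three: the inverse
  branches move (\<open>l / 4\<close>), the probabilities change while tested against
  \<open>f - f c\<close> (\<open>l\<close> times half of \<open>ln (2 + sqrt 3)\<close>), and the
  total mass changes while multiplied by \<open>f c\<close> (\<open>3 / M\<close>).\<close>

lemma scf_op_lip:
  assumes "1 \<le> M" "0 \<le> l" "scf_lip l f"
  shows "scf_lip ((1 / 4 + ln (2 + sqrt 3) / 2) * l + 3 / real M) (scf_op M f)"
proof -
  let ?S = "scf_symbols_upto M" and ?L = "ln (2 + sqrt 3)"
  have f01: "0 \<le> f x" "f x \<le> 1" if "x \<in> {0..1}" for x using assms(3) that unfolding scf_lip_def by auto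
  have fl: "\<bar>f x - f x'\<bar> \<le> l * \<bar>scf_coord x - scf_coord x'\<bar>" if "x \<in> {0..1}" "x' \<in> {0..1}" for x x'
    using assms(3) that unfolding scf_lip_def by auto
  have p0: "0 \<le> scf_prob \<omega> y" if "\<omega> \<in> ?S" "y \<in> {0..1}" for \<omega> y
    using scf_prob_nonneg[OF scf_symbols_uptoD] that by auto
  have inv: "scf_inv \<omega> y \<in> {0..1}" if "\<omega> \<in> ?S" "y \<in> {0..1}" for \<omega> y
    using scf_inv_mem[OF scf_symbols_uptoD] that by auto
  have sp: "(\<Sum>\<omega>\<in>?S. scf_prob \<omega> y) = 1 - scf_tail M y" and t: "0 \<le> scf_tail M y" "scf_tail M y \<le> 3 / real M"
    if "y \<in> {0..1}" for y
    using scf_prob_sum[OF assms(1)] scf_tail_bounds[OF assms(1)] that by auto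
  show ?thesis unfolding scf_lip_def
  proof (intro conjI ballI)
    fix y :: real assume y: "y \<in> {0..1}"
    have "0 \<le> scf_op M f y" unfolding scf_op_def
      by (intro sum_nonneg mult_nonneg_nonneg p0 f01 inv y)
    moreover have "scf_op M f y \<le> (\<Sum>\<omega>\<in>?S. scf_prob \<omega> y)" unfolding scf_op_def
      by (intro sum_mono mult_left_le f01 p0 inv y)
    ultimately show "scf_op M f y \<in> {0..1}" using sp[OF y] t[OF y] by simp
  next
    fix y z :: real assume y: "y \<in> {0..1}" and z: "z \<in> {0..1}"
    define d where "d = \<bar>scf_coord y - scf_coord z\<bar>"
    \<comment> \<open>Centring at the coordinate midpoint bounds \<open>f - f c\<close> by half the
      diameter.\<close>
    obtain c where c: "c \<in> {0..1}"
      and cL: "\<And>x. x \<in> {0..1} \<Longrightarrow> \<bar>scf_coord x - scf_coord c\<bar> \<le> ?L / 2"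
      using scf_coord_midpoint by blast
    have fc: "\<bar>f x - f c\<bar> \<le> l * (?L / 2)" if "x \<in> {0..1}" for x
      using fl[OF that c] mult_left_mono[OF cL[OF that] assms(2)] by linarith
    have "\<bar>\<Sum>\<omega>\<in>?S. scf_prob \<omega> y * (f (scf_inv \<omega> y) - f (scf_inv \<omega> z))\<bar>
      \<le> (\<Sum>\<omega>\<in>?S. scf_prob \<omega> y * (l * (1 / 4 * d)))"
    proof (rule order_trans[OF sum_abs sum_mono])
      fix \<omega> assume w: "\<omega> \<in> ?S"
      have "\<bar>f (scf_inv \<omega> y) - f (scf_inv \<omega> z)\<bar> \<le> l * (1 / 4 * d)"
        using fl[OF inv[OF w y] inv[OF w z]]
          mult_left_mono[OF scf_inv_contraction[OF scf_symbols_uptoD[OF w] y z] assms(2)]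
        unfolding d_def by linarith
      then show "\<bar>scf_prob \<omega> y * (f (scf_inv \<omega> y) - f (scf_inv \<omega> z))\<bar> \<le> scf_prob \<omega> y * (l * (1 / 4 * d))"
        unfolding abs_mult using p0[OF w y] by (simp only: abs_of_nonneg mult_left_mono)
    qed
    also have "\<dots> = (1 - scf_tail M y) * (l * (1 / 4 * d))"
      by (simp only: sum_distrib_right[symmetric] sp[OF y])
    also have "\<dots> \<le> 1 * (l * (1 / 4 * d))"
      using t[OF y] assms(2) d_def by (intro mult_right_mono) auto
    finally have 1: "\<bar>\<Sum>\<omega>\<in>?S. scf_prob \<omega> y * (f (scf_inv \<omega> y) - f (scf_inv \<omega> z))\<bar> \<le> 1 / 4 * l * d"
      by simp
    have "\<bar>\<Sum>\<omega>\<in>?S. (scf_prob \<omega> y - scf_prob \<omega> z) * (f (scf_inv \<omega> z) - f c)\<bar>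
      \<le> (\<Sum>\<omega>\<in>?S. d / 2 * (scf_prob \<omega> y + scf_prob \<omega> z) * (l * (?L / 2)))"
    proof (rule order_trans[OF sum_abs sum_mono])
      fix \<omega> assume w: "\<omega> \<in> ?S"
      show "\<bar>(scf_prob \<omega> y - scf_prob \<omega> z) * (f (scf_inv \<omega> z) - f c)\<bar>
        \<le> d / 2 * (scf_prob \<omega> y + scf_prob \<omega> z) * (l * (?L / 2))"
        unfolding abs_mult d_def
        by (intro mult_mono scf_prob_diff scf_symbols_uptoD[OF w] y z fc inv w)
          (use p0[OF w y] p0[OF w z] in auto)
    qed
    also have "\<dots> = d / 2 * ((1 - scf_tail M y) + (1 - scf_tail M z)) * (l * (?L / 2))"
      by (simp only: sum_distrib_right[symmetric] sum_distrib_left[symmetric] sum.distrib sp[OF y] sp[OF z])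
    also have "\<dots> \<le> d / 2 * 2 * (l * (?L / 2))"
      using t[OF y] t[OF z] assms(2) d_def ln_2_sqrt_3 by (intro mult_right_mono mult_left_mono) auto
    finally have 2: "\<bar>\<Sum>\<omega>\<in>?S. (scf_prob \<omega> y - scf_prob \<omega> z) * (f (scf_inv \<omega> z) - f c)\<bar> \<le> ?L / 2 * l * d"
      by (simp add: mult_ac)
    \<comment> \<open>The loss of mass enters only here: without the cutoff the probabilities would
      sum to 1 at both points and this term would vanish.\<close>
    have "\<bar>\<Sum>\<omega>\<in>?S. (scf_prob \<omega> y - scf_prob \<omega> z) * f c\<bar> = \<bar>scf_tail M y - scf_tail M z\<bar> * f c"
      using f01[OF c]
      by (simp only: sum_distrib_right[symmetric] sum_subtractf sp[OF y] sp[OF z] abs_mult)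
        (simp add: abs_minus_commute)
    also have "\<dots> \<le> \<bar>scf_tail M y - scf_tail M z\<bar> * 1"
      using f01[OF c] by (intro mult_left_mono) auto
    also have "\<dots> \<le> d / 2 * (scf_tail M y + scf_tail M z)"
      using scf_tail_diff[OF assms(1) y z] unfolding d_def by simp
    also have "\<dots> \<le> d / 2 * (3 / real M + 3 / real M)"
      using t[OF y] t[OF z] d_def by (intro mult_left_mono add_mono) auto
    finally have 3: "\<bar>\<Sum>\<omega>\<in>?S. (scf_prob \<omega> y - scf_prob \<omega> z) * f c\<bar> \<le> 3 / real M * d" by simp
    have "scf_op M f y - scf_op M f z =
      (\<Sum>\<omega>\<in>?S. scf_prob \<omega> y * (f (scf_inv \<omega> y) - f (scf_inv \<omega> z))) +
      (\<Sum>\<omega>\<in>?S. (scf_prob \<omega> y - scf_prob \<omega> z) * (f (scf_inv \<omega> z) - f c)) +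
      (\<Sum>\<omega>\<in>?S. (scf_prob \<omega> y - scf_prob \<omega> z) * f c)"
      unfolding scf_op_def sum.distrib[symmetric] sum_subtractf[symmetric]
      by (intro sum.cong refl) (simp add: algebra_simps)
    then have "\<bar>scf_op M f y - scf_op M f z\<bar> \<le> 1 / 4 * l * d + ?L / 2 * l * d + 3 / real M * d"
      using 1 2 3 by linarith
    then show "\<bar>scf_op M f y - scf_op M f z\<bar> \<le>
       ((1 / 4 + ?L / 2) * l + 3 / real M) * \<bar>scf_coord y - scf_coord z\<bar>"
      unfolding d_def[symmetric] by (simp add: algebra_simps)
  qed
qed

text \<open>The constant is the fixed point of the affine recursion in \<open>scf_op_lip\<close>;
  the starting function has Lipschitz constant 0.\<close>

lemma scf_op_iterate_lip:
  assumes "1 \<le> M"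
  shows "scf_lip (3 / (real M * (3 / 4 - ln (2 + sqrt 3) / 2))) ((scf_op M ^^ n) (\<lambda>_. 1))"
proof (induction n)
  case 0
  show ?case using ln_2_sqrt_3 by (auto simp: scf_lip_def)
next
  case (Suc n)
  define q where "q = 3 / 4 - ln (2 + sqrt 3) / 2"
  have q: "0 < q" unfolding q_def using ln_2_sqrt_3 by simp
  have M: "0 < real M" using assms by simp
  have "scf_lip ((1 - q) * (3 / (real M * q)) + 3 / real M) ((scf_op M ^^ Suc n) (\<lambda>_. 1))"
    using scf_op_lip[OF assms _ Suc.IH] q M unfolding q_def by simp
  also have "(1 - q) * (3 / (real M * q)) + 3 / real M = 3 / (real M * q)"
    using q M by (simp add: field_simps)
  finally show ?case unfolding q_def .
qed

section \<open>The symbolic partition\<close>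

text \<open>Branches and inverse branches have rational coefficients. Irrational points therefore
  stay irrational along the orbit and never meet an interval endpoint, and the rationals form a null
  set.\<close>

lemma scf_branch_Rats: "x \<in> \<rat> \<Longrightarrow> scf_branch \<omega> x \<in> \<rat>"
  by (cases "(\<omega>, x)" rule: scf_branch.cases) auto

lemma scf_inv_Rats: "y \<in> \<rat> \<Longrightarrow> scf_inv \<omega> y \<in> \<rat>"
  unfolding scf_inv_def
  by (cases "(\<omega>, y)" rule: scf_branch.cases) auto

lemma scf_inv_irrational:
  assumes "\<omega> \<in> scf_alphabet" "y \<in> {0<..<1} - \<rat>"
  shows "scf_inv \<omega> y \<in> scf_interval \<omega>" "scf_branch \<omega> (scf_inv \<omega> y) = y"
    "scf_inv \<omega> y \<in> {0<..<1} - \<rat>"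
proof -
  have y: "0 < y" "y < 1" using assms by auto
  then have D: "0 < scf_den \<omega> y" "0 < scf_num \<omega> y" "scf_num \<omega> y < scf_den \<omega> y"
    using scf_den_pos scf_num_bounds assms(1) by auto
  show "scf_inv \<omega> y \<in> scf_interval \<omega>"
    using assms(1)
  proof (cases rule: scf_alphabet_cases)
    case (1 k)
    then show ?thesis using y D unfolding scf_inv_def by (auto simp: field_simps)
  next
    case (2 k)
    then show ?thesis using y D unfolding scf_inv_def by (auto simp: field_simps)
  next
    case (3 k)
    have "real k * y < real k * 1" using 3 y by (intro mult_strict_left_mono) auto
    then show ?thesis using 3 y D unfolding scf_inv_def by (auto simp: field_simps)
  next
    case (4 k)
    have "real k * y < real k * 1" using 4 y by (intro mult_strict_left_mono) auto
    then show ?thesis using 4 y D unfolding scf_inv_def by (auto simp: field_simps)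
  qed
  show b: "scf_branch \<omega> (scf_inv \<omega> y) = y"
    using assms(1)
  proof (cases rule: scf_alphabet_cases)
    case (3 k)
    have "real k - (real k + 1) * scf_inv \<omega> y = y / scf_den \<omega> y"
      "real k * scf_inv \<omega> y - (real k - 1) = 1 / scf_den \<omega> y"
      unfolding scf_inv_def using D 3 by (simp_all add: field_simps)
    then show ?thesis using D(1) unfolding 3 by simp
  next
    case (4 k)
    have "real k - (real k + 1) * scf_inv \<omega> y = 1 / scf_den \<omega> y"
      "real k * scf_inv \<omega> y - (real k - 1) = y / scf_den \<omega> y"
      unfolding scf_inv_def using D 4 by (simp_all add: field_simps)
    then show ?thesis using D(1) unfolding 4 by simp
  qed (auto simp: scf_inv_def)
  have "scf_inv \<omega> y \<notin> \<rat>" using scf_branch_Rats[of "scf_inv \<omega> y" \<omega>] b assms by auto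
  then show "scf_inv \<omega> y \<in> {0<..<1} - \<rat>" using D by (simp add: scf_inv_def)
qed

lemma floor_eq_of_irrational:
  fixes u :: real
  assumes "u \<notin> \<rat>" "of_int n \<le> u" "u \<le> of_int n + 1" shows "\<lfloor>u\<rfloor> = n"
proof -
  have "u \<noteq> of_int n + 1" using assms(1) by (metis Rats_of_int Rats_add Rats_1)
  then show ?thesis using assms by (simp add: floor_eq_iff)
qed

text \<open>\<open>1 / x\<close> maps the even intervals, and \<open>2 * x / (1 - x)\<close> the odd
  ones, onto unit intervals between consecutive integers, with alternating sign
  \<open>\<epsilon>\<close>. So the half of the unit interval and one floor determine the
  symbol.\<close>

lemma scf_interval_code:
  assumes "\<omega> \<in> scf_alphabet" "x \<in> {0<..<1} - \<rat>" "x \<in> scf_interval \<omega>"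
  shows "x < 1 / 2 \<longleftrightarrow> snd (snd \<omega>) = Par_e"
    "snd (snd \<omega>) = Par_e \<Longrightarrow>
      \<lfloor>1 / x\<rfloor> = (if fst (snd \<omega>) = 1 then 2 * int (fst \<omega>) else 2 * int (fst \<omega>) - 1)"
    "snd (snd \<omega>) = Par_o \<Longrightarrow>
      \<lfloor>2 * x / (1 - x)\<rfloor> = (if fst (snd \<omega>) = 1 then 2 * int (fst \<omega>) - 1 else 2 * int (fst \<omega>) - 2)"
proof -
  have x: "0 < x" "x < 1" "x \<notin> \<rat>" using assms(2) by auto
  have h: "x \<noteq> 1 / 2" using x(3) by (metis Rats_divide Rats_1 Rats_number_of)
  have u: "1 / x \<notin> \<rat>"
  proof
    assume "1 / x \<in> \<rat>"
    then have r: "1 / (1 / x) \<in> \<rat>" by (rule Rats_divide[OF Rats_1])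
    have e: "1 / (1 / x) = x" by simp
    show False using r x(3) unfolding e by simp
  qed
  have v: "2 * x / (1 - x) \<notin> \<rat>"
  proof
    assume a: "2 * x / (1 - x) \<in> \<rat>"
    have "(2 * x / (1 - x)) / (2 + 2 * x / (1 - x)) \<in> \<rat>" by (rule Rats_divide[OF a Rats_add[OF _ a]]) simp
    moreover have "(2 * x / (1 - x)) / (2 + 2 * x / (1 - x)) = x" using x by (simp add: field_simps)
    ultimately show False using x by simp
  qed
  have "(x < 1 / 2 \<longleftrightarrow> snd (snd \<omega>) = Par_e) \<and>
    (snd (snd \<omega>) = Par_e \<longrightarrow>
      \<lfloor>1 / x\<rfloor> = (if fst (snd \<omega>) = 1 then 2 * int (fst \<omega>) else 2 * int (fst \<omega>) - 1)) \<and>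
    (snd (snd \<omega>) = Par_o \<longrightarrow>
      \<lfloor>2 * x / (1 - x)\<rfloor> = (if fst (snd \<omega>) = 1 then 2 * int (fst \<omega>) - 1 else 2 * int (fst \<omega>) - 2))"
    using assms(1)
  proof (cases rule: scf_alphabet_cases)
    case (1 k)
    have le: "1 / (2 * real k + 1) \<le> x" "x \<le> 1 / (2 * real k)"
      using assms(3) 1 by (auto split: if_splits)
    moreover have "1 / (2 * real k) \<le> 1 / 2" using 1 by (intro frac_le) auto
    ultimately have "x \<le> 1 / 2" by linarith
    moreover have "\<lfloor>1 / x\<rfloor> = 2 * int k"
      by (rule floor_eq_of_irrational[OF u]) (use le x 1 in \<open>auto simp: field_simps\<close>)
    ultimately show ?thesis using 1 h by simp
  next
    case (2 k)
    have le: "1 / (2 * real k) \<le> x" "x < 1 / (2 * real k - 1)"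
      using assms(3) 2 by auto
    moreover have "1 / (2 * real k - 1) \<le> 1 / 2" using 2 by (intro frac_le) auto
    ultimately have "x < 1 / 2" by linarith
    moreover have "\<lfloor>1 / x\<rfloor> = 2 * int k - 1"
      by (rule floor_eq_of_irrational[OF u]) (use le x 2 in \<open>auto simp: field_simps\<close>)
    ultimately show ?thesis using 2 by simp
  next
    case (3 k)
    have le: "(2 * real k - 1) / (2 * real k + 1) < x" "x \<le> real k / (real k + 1)"
      using assms(3) 3 by auto
    have "1 / 2 \<le> (2 * real k - 1) / (2 * real k + 1)" using 3 by (simp add: field_simps)
    with le have "1 / 2 < x" by linarith
    moreover have "\<lfloor>2 * x / (1 - x)\<rfloor> = 2 * int k - 1"
      by (rule floor_eq_of_irrational[OF v]) (use le x 3 in \<open>auto simp: field_simps\<close>)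
    ultimately show ?thesis using 3 le by simp
  next
    case (4 k)
    have le: "(real k - 1) / real k < x" "x \<le> (2 * real k - 1) / (2 * real k + 1)"
      using assms(3) 4 by auto
    have "1 / 2 \<le> (real k - 1) / real k" using 4 by (simp add: field_simps)
    with le have "1 / 2 < x" by linarith
    moreover have "\<lfloor>2 * x / (1 - x)\<rfloor> = 2 * int k - 2"
      by (rule floor_eq_of_irrational[OF v]) (use le x 4 in \<open>auto simp: field_simps\<close>)
    ultimately show ?thesis using 4 le by simp
  qed
  then show "x < 1 / 2 \<longleftrightarrow> snd (snd \<omega>) = Par_e"
    "snd (snd \<omega>) = Par_e \<Longrightarrow>
      \<lfloor>1 / x\<rfloor> = (if fst (snd \<omega>) = 1 then 2 * int (fst \<omega>) else 2 * int (fst \<omega>) - 1)"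
    "snd (snd \<omega>) = Par_o \<Longrightarrow>
      \<lfloor>2 * x / (1 - x)\<rfloor> = (if fst (snd \<omega>) = 1 then 2 * int (fst \<omega>) - 1 else 2 * int (fst \<omega>) - 2)"
    by auto
qed

lemma scf_interval_unique:
  assumes "\<omega> \<in> scf_alphabet" "\<omega>' \<in> scf_alphabet" "x \<in> {0<..<1} - \<rat>"
    "x \<in> scf_interval \<omega>" "x \<in> scf_interval \<omega>'"
  shows "\<omega> = \<omega>'"
proof -
  obtain k \<epsilon> s k' \<epsilon>' s' where w: "\<omega> = (k, \<epsilon>, s)" "\<omega>' = (k', \<epsilon>', s')" by (cases \<omega>, cases \<omega>')
  have e: "\<epsilon> = 1 \<or> \<epsilon> = -1" "\<epsilon>' = 1 \<or> \<epsilon>' = -1" using assms(1,2) w by (auto simp: scf_alphabet_def)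
  note c = scf_interval_code[OF assms(1,3,4)] and c' = scf_interval_code[OF assms(2,3,5)]
  have s: "s = s'" using c(1) c'(1) w by (cases s; cases s') auto
  have "(if \<epsilon> = 1 then 2 * int k else 2 * int k - 1) = (if \<epsilon>' = 1 then 2 * int k' else 2 * int k' - 1)"
  proof (cases s)
    case Par_e
    then show ?thesis using c(2) c'(2) s unfolding w fst_conv snd_conv by simp
  next
    case Par_o
    then have "(if \<epsilon> = 1 then 2 * int k - 1 else 2 * int k - 2) =
        (if \<epsilon>' = 1 then 2 * int k' - 1 else 2 * int k' - 2)" using c(3) c'(3) s unfolding w fst_conv snd_conv by simp
    then show ?thesis by (auto split: if_splits)
  qed
  then have "k = k' \<and> \<epsilon> = \<epsilon>'" using e by (auto split: if_splits; presburger)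
  then show ?thesis using w s by simp
qed

lemma scf_interval_exists:
  assumes "x \<in> {0<..<1} - \<rat>"
  obtains \<omega> where "\<omega> \<in> scf_alphabet" "x \<in> scf_interval \<omega>"
proof (cases "x < 1 / 2")
  case True
  have x: "0 < x" using assms by auto
  define n where "n = \<lfloor>1 / x\<rfloor>"
  have n: "of_int n \<le> 1 / x" "1 / x < of_int n + 1" unfolding n_def by linarith+
  have "2 < 1 / x" using True x by (simp add: field_simps)
  then have n2: "2 \<le> n" using n by linarith
  show thesis
  proof (cases "even n")
    case True
    then have "n = 2 * int (nat (n div 2))" using n2 by simp
    then obtain k where k: "n = 2 * int k" by blast
    have x1: "1 / (2 * real k + 1) \<le> x" "x \<le> 1 / (2 * real k)"
      using n x n2 unfolding k by (auto simp: field_simps)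
    have "x \<noteq> 1 / (2 * real k)" using assms by (auto simp del: of_nat_mult)
    then show thesis using x1 n2 k by (intro that[of "(k, 1, Par_e)"]) (auto simp: scf_alphabet_def)
  next
    case False
    then have "2 * ((n + 1) div 2) = n + 1" by presburger
    then have "n = 2 * int (nat ((n + 1) div 2)) - 1" using n2 by simp
    then obtain k where k: "n = 2 * int k - 1" by blast
    have k2: "2 \<le> k" using n2 k by simp
    have x1: "1 / (2 * real k) \<le> x" "x \<le> 1 / (2 * real k - 1)"
      using n x k2 unfolding k by (auto simp: field_simps)
    have "x \<noteq> 1 / (2 * real k - 1)" using assms by (auto)
    then show thesis using x1 k2 by (intro that[of "(k, -1, Par_e)"]) (auto simp: scf_alphabet_def)
  qed
next
  case False
  have x: "0 < x" "x < 1" using assms by auto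
  have "x \<noteq> 1 / 2" using assms by (metis DiffD2 Rats_divide Rats_1 Rats_number_of)
  with False have h: "1 / 2 < x" by simp
  \<comment> \<open>A ceiling instead of a floor, as the odd intervals are open on the left and
    closed on the right. That \<open>n\<close> is at least 3 ensures index at least 2.\<close>
  define n where "n = \<lceil>2 * x / (1 - x)\<rceil>"
  have n: "of_int n - 1 < 2 * x / (1 - x)" "2 * x / (1 - x) \<le> of_int n" unfolding n_def by linarith+
  have "2 < 2 * x / (1 - x)" using h x by (simp add: field_simps)
  then have n2: "3 \<le> n" using n by linarith
  show thesis
  proof (cases "even n")
    case True
    then have "n = 2 * int (nat (n div 2))" using n2 by simp
    then obtain k where k: "n = 2 * int k" by blast
    have "(2 * real k - 1) / (2 * real k + 1) < x" "x \<le> real k / (real k + 1)"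
      using n x n2 unfolding k by (auto simp: field_simps)
    then show thesis using n2 k by (intro that[of "(k, 1, Par_o)"]) (auto simp: scf_alphabet_def)
  next
    case False
    then have "2 * ((n + 1) div 2) = n + 1" by presburger
    then have "n = 2 * int (nat ((n + 1) div 2)) - 1" using n2 by simp
    then obtain k where k: "n = 2 * int k - 1" by blast
    have k2: "2 \<le> k" using n2 k by simp
    have "(real k - 1) / real k < x" "x \<le> (2 * real k - 1) / (2 * real k + 1)"
      using n x k2 unfolding k by (auto simp: field_simps)
    then show thesis using k2 by (intro that[of "(k, -1, Par_o)"]) (auto simp: scf_alphabet_def)
  qed
qed

lemma scf_symbol_of_eq:
  assumes "x \<in> {0<..<1} - \<rat>" "\<omega> \<in> scf_alphabet" "x \<in> scf_interval \<omega>"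
  shows "scf_symbol_of x = \<omega>"
  unfolding scf_symbol_of_def using assms scf_interval_unique by (intro the_equality) auto

lemma moebius_quotient:
  fixes a b c d u v :: real
  assumes "v \<noteq> 0"
  shows "(a + b * (u / v)) / (c + d * (u / v)) = (a * v + b * u) / (c * v + d * u)"
proof -
  have "a + b * (u / v) = (a * v + b * u) / v" "c + d * (u / v) = (c * v + d * u) / v"
    using assms by (simp_all add: field_simps)
  then show ?thesis using assms by simp
qed

lemma scf_branch_irrational:
  assumes "\<omega> \<in> scf_alphabet" "x \<in> {0<..<1} - \<rat>" "x \<in> scf_interval \<omega>"
  shows "scf_branch \<omega> x \<in> {0<..<1} - \<rat>" "scf_inv \<omega> (scf_branch \<omega> x) = x"
proof -
  have x: "0 < x" "x < 1" "x \<notin> \<rat>" using assms(2) by auto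
  have "scf_inv \<omega> (scf_branch \<omega> x) = x \<and> 0 \<le> scf_branch \<omega> x \<and> scf_branch \<omega> x \<le> 1"
    using assms(1)
  proof (cases rule: scf_alphabet_cases)
    case (1 k)
    have le: "1 / (2 * real k + 1) \<le> x" "x \<le> 1 / (2 * real k)"
      using assms(3) 1 by (auto split: if_splits)
    then show ?thesis using 1 x by (auto simp: scf_inv_def field_simps)
  next
    case (2 k)
    have le: "1 / (2 * real k) \<le> x" "x < 1 / (2 * real k - 1)" using assms(3) 2 by auto
    then show ?thesis using 2 x by (auto simp: scf_inv_def field_simps)
  next
    case (3 k)
    have le: "(2 * real k - 1) / (2 * real k + 1) < x" "x \<le> real k / (real k + 1)"
      using assms(3) 3 by auto
    \<comment> \<open>Homogeneous coordinates: the branch value is \<open>u / v\<close>, and the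
      matrix of the inverse branch maps \<open>(v, u)\<close> to \<open>(x, 1)\<close>, as
      \<open>n\<close> and \<open>d\<close> record.\<close>
    define u v where "u = real k - (real k + 1) * x" and "v = real k * x - (real k - 1)"
    have uv: "0 \<le> u" "u \<le> v" unfolding u_def v_def using le 3 by (auto simp: field_simps)
    have d: "(real k + 1) * v + real k * u = 1" and n: "real k * v + (real k - 1) * u = x"
      unfolding u_def v_def by (simp_all add: algebra_simps)
    have "v \<noteq> 0"
    proof
      assume "v = 0"
      with uv have "u = 0" by simp
      with d \<open>v = 0\<close> show False by simp
    qed
    with uv have v: "0 < v" by simp
    have "(real k + (real k - 1) * (u / v)) / ((real k + 1) + real k * (u / v)) =
       (real k * v + (real k - 1) * u) / ((real k + 1) * v + real k * u)"
      by (rule moebius_quotient) (use v in simp)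
    then show ?thesis using v uv 3 unfolding d n by (simp add: scf_inv_def u_def v_def)
  next
    case (4 k)
    have le: "(real k - 1) / real k < x" "x \<le> (2 * real k - 1) / (2 * real k + 1)"
      using assms(3) 4 by auto
    define v u where "v = real k - (real k + 1) * x" and "u = real k * x - (real k - 1)"
    have uv: "0 \<le> u" "u \<le> v" unfolding u_def v_def using le 4 by (auto simp: field_simps)
    have d: "real k * v + (real k + 1) * u = 1" and n: "(real k - 1) * v + real k * u = x"
      unfolding u_def v_def by (simp_all add: algebra_simps)
    have "v \<noteq> 0"
    proof
      assume "v = 0"
      with uv have "u = 0" by simp
      with d \<open>v = 0\<close> show False by simp
    qed
    with uv have v: "0 < v" by simp
    have "((real k - 1) + real k * (u / v)) / (real k + (real k + 1) * (u / v)) =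
       ((real k - 1) * v + real k * u) / (real k * v + (real k + 1) * u)"
      by (rule moebius_quotient) (use v in simp)
    then show ?thesis using v uv 4 unfolding d n by (simp add: scf_inv_def u_def v_def)
  qed
  moreover from this have "scf_branch \<omega> x \<notin> \<rat>" using scf_inv_Rats x(3) by metis
  moreover from this have "scf_branch \<omega> x \<noteq> 0" "scf_branch \<omega> x \<noteq> 1" by (metis Rats_0, metis Rats_1)
  ultimately show "scf_branch \<omega> x \<in> {0<..<1} - \<rat>" "scf_inv \<omega> (scf_branch \<omega> x) = x" by auto
qed

text \<open>The iterate with index \<open>j\<close> carries digit number \<open>j + 1\<close>, so
  this is the event that the first \<open>n\<close> digits are at most \<open>M\<close>.\<close>

definition scf_low :: "nat \<Rightarrow> nat \<Rightarrow> real set" where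
  "scf_low M n = {x \<in> {0<..<1} - \<rat>. \<forall>j<n. fst (scf_symbol_of ((scf_map ^^ j) x)) \<le> M}"

lemma scf_low_0: "scf_low M 0 = {0<..<1} - \<rat>"
  by (auto simp: scf_low_def)

text \<open>Splits off the first digit; the later digits are those of the image point. Every branch
  is full, so that point ranges over all of \<open>scf_low M n\<close>.\<close>

lemma scf_low_Suc: "scf_low M (Suc n) = (\<Union>\<omega>\<in>scf_symbols_upto M. scf_inv \<omega> ` scf_low M n)"
proof (intro set_eqI iffI)
  fix x assume x: "x \<in> scf_low M (Suc n)"
  then have x01: "x \<in> {0<..<1} - \<rat>" by (simp add: scf_low_def)
  then obtain \<omega> where w: "\<omega> \<in> scf_alphabet" "x \<in> scf_interval \<omega>" by (rule scf_interval_exists)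
  have s: "scf_symbol_of x = \<omega>" using scf_symbol_of_eq x01 w by blast
  have m: "scf_map x = scf_branch \<omega> x" using x01 s by (simp add: scf_map_def)
  have "fst \<omega> \<le> M" using x s unfolding scf_low_def by force
  then have "\<omega> \<in> scf_symbols_upto M" using w by (simp add: scf_symbols_upto_def)
  moreover have "fst (scf_symbol_of ((scf_map ^^ j) (scf_branch \<omega> x))) \<le> M" if "j < n" for j
  proof -
    have "fst (scf_symbol_of ((scf_map ^^ Suc j) x)) \<le> M" using x that unfolding scf_low_def by blast
    then show ?thesis unfolding funpow_Suc_right comp_def m .
  qed
  then have "scf_branch \<omega> x \<in> scf_low M n"
    using scf_branch_irrational(1)[OF w(1) x01 w(2)] unfolding scf_low_def by blast
  moreover have "x = scf_inv \<omega> (scf_branch \<omega> x)" using scf_branch_irrational(2)[OF w(1) x01 w(2)] ..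
  ultimately show "x \<in> (\<Union>\<omega>\<in>scf_symbols_upto M. scf_inv \<omega> ` scf_low M n)" by blast
next
  fix x assume "x \<in> (\<Union>\<omega>\<in>scf_symbols_upto M. scf_inv \<omega> ` scf_low M n)"
  then obtain \<omega> y where w: "\<omega> \<in> scf_symbols_upto M" and y: "y \<in> scf_low M n" and x: "x = scf_inv \<omega> y" by blast
  note wa = scf_symbols_uptoD[OF w]
  have y01: "y \<in> {0<..<1} - \<rat>" using y by (simp add: scf_low_def)
  note i = scf_inv_irrational[OF wa y01, folded x]
  have s: "scf_symbol_of x = \<omega>" using scf_symbol_of_eq[OF i(3) wa i(1)] .
  have m: "scf_map x = y" using i s by (simp add: scf_map_def)
  have "fst (scf_symbol_of ((scf_map ^^ j) x)) \<le> M" if "j < Suc n" for j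
  proof (cases j)
    case 0
    then show ?thesis using s w by (simp add: scf_symbols_upto_def)
  next
    case (Suc j')
    have "(scf_map ^^ Suc j') x = (scf_map ^^ j') y" unfolding funpow_Suc_right comp_def m ..
    moreover have "j' < n" using that Suc by simp
    ultimately show ?thesis using y unfolding scf_low_def Suc by (simp only:) blast
  qed
  then show "x \<in> scf_low M (Suc n)" using i(3) unfolding scf_low_def by blast
qed

lemma scf_inv_inj: "\<omega> \<in> scf_alphabet \<Longrightarrow> inj_on (scf_inv \<omega>) ({0<..<1} - \<rat>)"
  using scf_inv_irrational(2) by (intro inj_on_inverseI[of _ "scf_branch \<omega>"]) blast

lemma scf_inv_disjoint:
  assumes "\<omega> \<in> scf_alphabet" "\<omega>' \<in> scf_alphabet" "\<omega> \<noteq> \<omega>'"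
  shows "scf_inv \<omega> ` ({0<..<1} - \<rat>) \<inter> scf_inv \<omega>' ` ({0<..<1} - \<rat>) = {}"
proof -
  have "scf_inv \<omega> y \<noteq> scf_inv \<omega>' y'" if "y \<in> {0<..<1} - \<rat>" "y' \<in> {0<..<1} - \<rat>" for y y'
  proof
    assume eq: "scf_inv \<omega> y = scf_inv \<omega>' y'"
    note i = scf_inv_irrational[OF assms(1) that(1)]
    have "scf_inv \<omega> y \<in> scf_interval \<omega>'" unfolding eq by (rule scf_inv_irrational(1)[OF assms(2) that(2)])
    then have "\<omega> = \<omega>'" using scf_interval_unique[OF assms(1,2) i(3,1)] by simp
    with assms(3) show False ..
  qed
  then show ?thesis by blast
qed

section \<open>Borel measurability of the cylinder sets\<close>

lemma scf_interval_borel: "scf_interval \<omega> \<in> sets borel"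
  by (cases \<omega> rule: scf_interval.cases) auto

lemma scf_branch_measurable: "scf_branch \<omega> \<in> borel_measurable borel"
proof -
  obtain k \<epsilon> s where w: "\<omega> = (k, \<epsilon>, s)" by (cases \<omega>)
  show ?thesis
  proof (cases s)
    case Par_e
    then have "scf_branch \<omega> = (\<lambda>x. if \<epsilon> = 1 then 1 / x - 2 * real k else 2 * real k - 1 / x)"
      using w by auto
    then show ?thesis by simp
  next
    case Par_o
    then have "scf_branch \<omega> = (\<lambda>x. if \<epsilon> = 1
      then (real k - (real k + 1) * x) / (real k * x - (real k - 1))
      else (real k * x - (real k - 1)) / (real k - (real k + 1) * x))" using w by auto
    then show ?thesis by simp
  qed
qed

lemma irrational_unit_borel: "{0<..<1::real} - \<rat> \<in> sets borel"
proof -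
  have "(\<rat> :: real set) \<in> sets borel" by (rule sets.countable[OF _ countable_rat]) simp
  then show ?thesis by (intro sets.Diff) auto
qed

text \<open>Exhibits the image as a preimage under the Borel map \<open>scf_branch \<omega>\<close>,
  from which its measurability follows.\<close>

lemma scf_inv_image:
  assumes "\<omega> \<in> scf_alphabet" "E \<subseteq> {0<..<1} - \<rat>"
  shows "scf_inv \<omega> ` E = ({0<..<1} - \<rat>) \<inter> scf_interval \<omega> \<inter> (scf_branch \<omega> -` E \<inter> space borel)"
proof (intro set_eqI iffI)
  fix x assume "x \<in> scf_inv \<omega> ` E"
  then obtain y where y: "y \<in> E" "x = scf_inv \<omega> y" by blast
  then have "y \<in> {0<..<1} - \<rat>" using assms(2) by blast
  from scf_inv_irrational[OF assms(1) this]
  show "x \<in> ({0<..<1} - \<rat>) \<inter> scf_interval \<omega> \<inter> (scf_branch \<omega> -` E \<inter> space borel)"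
    using y by simp
next
  fix x assume x: "x \<in> ({0<..<1} - \<rat>) \<inter> scf_interval \<omega> \<inter> (scf_branch \<omega> -` E \<inter> space borel)"
  then have "scf_inv \<omega> (scf_branch \<omega> x) = x" using scf_branch_irrational(2)[OF assms(1)] by blast
  with x show "x \<in> scf_inv \<omega> ` E" by (metis IntD2 IntD1 vimageD imageI)
qed

lemma scf_low_subset: "scf_low M n \<subseteq> {0<..<1} - \<rat>"
  by (auto simp: scf_low_def)

lemma scf_inv_image_borel:
  assumes "\<omega> \<in> scf_alphabet" "E \<subseteq> {0<..<1} - \<rat>" "E \<in> sets borel"
  shows "scf_inv \<omega> ` E \<in> sets borel"
  unfolding scf_inv_image[OF assms(1,2)]
  by (intro sets.Int irrational_unit_borel scf_interval_borel
      measurable_sets[OF scf_branch_measurable] assms(3))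

lemma scf_low_borel: "scf_low M n \<in> sets borel"
proof (induction n)
  case 0
  show ?case unfolding scf_low_0 by (rule irrational_unit_borel)
next
  case (Suc n)
  then show ?case unfolding scf_low_Suc
    by (intro sets.finite_UN finite_scf_symbols_upto scf_inv_image_borel scf_low_subset)
      (auto dest: scf_symbols_uptoD)
qed

section \<open>Integrals over cylinder sets\<close>

lemma scf_lip_continuous:
  assumes "scf_lip l f" shows "continuous_on {0..1} f"
  unfolding continuous_on_def
proof
  fix x :: real assume x: "x \<in> {0..1}"
  have "((\<lambda>z. l * \<bar>scf_coord z - scf_coord x\<bar>) \<longlongrightarrow> l * \<bar>scf_coord x - scf_coord x\<bar>) (at x within {0..1})"
    using continuous_on_scf_coord x unfolding continuous_on_def by (intro tendsto_intros) auto
  then have "((\<lambda>z. l * \<bar>scf_coord z - scf_coord x\<bar>) \<longlongrightarrow> 0) (at x within {0..1})" by simp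
  then have "((\<lambda>z. f z - f x) \<longlongrightarrow> 0) (at x within {0..1})"
    by (rule Lim_null_comparison[rotated])
      (use assms x in \<open>auto simp: scf_lip_def eventually_at_filter intro!: eventuallyI\<close>)
  then show "(f \<longlongrightarrow> f x) (at x within {0..1})" by (simp add: LIM_zero_iff)
qed

lemma scf_weighted_continuous:
  assumes "continuous_on {0..1} f" shows "continuous_on {0..1} (\<lambda>x. f x / scf_weight x)"
proof (intro continuous_on_divide assms)
  show "continuous_on {0..1} scf_weight" unfolding scf_weight_def[abs_def] by (intro continuous_intros)
  show "\<forall>x\<in>{0..1}. scf_weight x \<noteq> 0" using scf_weight_pos by (auto simp: less_le)
qed

lemma scf_weighted_integrable:
  assumes "continuous_on {0..1} f" "E \<in> sets borel" "E \<subseteq> {0..1}"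
  shows "(\<lambda>x. f x / scf_weight x) absolutely_integrable_on E"
  using absolutely_integrable_continuous_real[OF scf_weighted_continuous[OF assms(1)]]
  by (rule set_integrable_subset) (use assms in auto)

lemma scf_low_subset_01: "scf_low M n \<subseteq> {0..1}"
  by (auto simp: scf_low_def)

lemma negligible_rat: "negligible (\<rat> :: real set)"
  unfolding negligible_iff_null_sets
  by (intro null_sets_completionI countable_imp_null_set_lborel countable_rat)

lemma scf_low_0_integral: "integral (scf_low M 0) g = integral {0..1} (g :: real \<Rightarrow> real)"
proof (rule integral_subset_negligible)
  have "negligible (\<rat> \<union> {0, 1 :: real})" using negligible_rat by simp
  then show "negligible ({0..1} - scf_low M 0)"
    by (rule negligible_subset) (auto simp: scf_low_0)
qed (auto simp: scf_low_0)

lemma scf_inv_integral: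
  assumes "\<omega> \<in> scf_alphabet" "E \<in> sets borel" "E \<subseteq> {0<..<1} - \<rat>" "continuous_on {0..1} f"
  shows "(\<lambda>y. scf_prob \<omega> y * f (scf_inv \<omega> y) / scf_weight y) integrable_on E"
    "integral (scf_inv \<omega> ` E) (\<lambda>x. f x / scf_weight x)
      = integral E (\<lambda>y. scf_prob \<omega> y * f (scf_inv \<omega> y) / scf_weight y)"
proof -
  let ?g = "\<lambda>x. f x / scf_weight x" and ?h = "\<lambda>y. scf_prob \<omega> y * f (scf_inv \<omega> y) / scf_weight y"
  have E: "y \<in> {0..1}" if "y \<in> E" for y using assms(3) that by auto
  have eq: "\<bar>scf_inv_deriv \<omega> y\<bar> * ?g (scf_inv \<omega> y) = ?h y" if "y \<in> E" for y
  proof -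
    have y: "0 \<le> y" "y \<le> 1" using E[OF that] by auto
    have "\<bar>scf_inv_deriv \<omega> y\<bar> * ?g (scf_inv \<omega> y)
      = f (scf_inv \<omega> y) * (\<bar>scf_inv_deriv \<omega> y\<bar> / scf_weight (scf_inv \<omega> y))" by simp
    then show ?thesis unfolding scf_inv_deriv_weight[OF assms(1) y] by simp
  qed
  have ai: "?g absolutely_integrable_on scf_inv \<omega> ` E"
    using scf_inv_mem[OF assms(1)] E
    by (intro scf_weighted_integrable assms scf_inv_image_borel) blast
  have "(\<lambda>y. \<bar>scf_inv_deriv \<omega> y\<bar> * ?g (scf_inv \<omega> y)) absolutely_integrable_on E \<and>
    integral E (\<lambda>y. \<bar>scf_inv_deriv \<omega> y\<bar> * ?g (scf_inv \<omega> y)) = integral (scf_inv \<omega> ` E) ?g"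
  proof (rule iffD2[OF has_absolute_integral_change_of_variables_1'[where g = "scf_inv \<omega>" and f = ?g]])
    show "E \<in> sets lebesgue" using assms(2) by simp
    show "(scf_inv \<omega> has_field_derivative scf_inv_deriv \<omega> y) (at y within E)" if "y \<in> E" for y
      using scf_inv_has_deriv[OF assms(1)] E[OF that] by auto
    show "inj_on (scf_inv \<omega>) E" using scf_inv_inj[OF assms(1)] assms(3) by (rule inj_on_subset)
  qed (use ai in auto)
  then have i: "(\<lambda>y. \<bar>scf_inv_deriv \<omega> y\<bar> * ?g (scf_inv \<omega> y)) integrable_on E"
    and e: "integral E (\<lambda>y. \<bar>scf_inv_deriv \<omega> y\<bar> * ?g (scf_inv \<omega> y)) = integral (scf_inv \<omega> ` E) ?g"
    using set_lebesgue_integral_eq_integral(1) by blast+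
  show "?h integrable_on E" using integrable_eq[OF i eq] by simp
  show "integral (scf_inv \<omega> ` E) ?g = integral E ?h" unfolding e[symmetric] by (rule integral_cong[OF eq])
qed

text \<open>Duality of map and transfer operator: the integral is pulled back along each inverse
  branch, whose images are disjoint, and the Jacobians turn into \<open>scf_prob\<close>.\<close>

lemma scf_low_integral_Suc:
  assumes "continuous_on {0..1} f"
  shows "integral (scf_low M (Suc n)) (\<lambda>x. f x / scf_weight x)
     = integral (scf_low M n) (\<lambda>x. scf_op M f x / scf_weight x)"
proof -
  let ?g = "\<lambda>x. f x / scf_weight x" and ?S = "scf_symbols_upto M" and ?E = "scf_low M n"
  have gi: "?g integrable_on scf_inv \<omega> ` ?E" if "\<omega> \<in> ?S" for \<omega>
    using scf_inv_mem[OF scf_symbols_uptoD[OF that]] scf_low_subset_01[of M n]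
    by (intro set_lebesgue_integral_eq_integral(1) scf_weighted_integrable assms
        scf_inv_image_borel scf_symbols_uptoD[OF that] scf_low_subset scf_low_borel) blast
  have "(?g has_integral (\<Sum>\<omega>\<in>?S. integral (scf_inv \<omega> ` ?E) ?g)) (\<Union>\<omega>\<in>?S. scf_inv \<omega> ` ?E)"
  proof (rule has_integral_UN[OF finite_scf_symbols_upto])
    show "(?g has_integral integral (scf_inv \<omega> ` ?E) ?g) (scf_inv \<omega> ` ?E)" if "\<omega> \<in> ?S" for \<omega>
      using gi[OF that] by (rule integrable_integral)
    show "pairwise (\<lambda>\<omega> \<omega>'. negligible (scf_inv \<omega> ` ?E \<inter> scf_inv \<omega>' ` ?E)) ?S"
    proof (rule pairwiseI)
      fix \<omega> \<omega>' assume w: "\<omega> \<in> ?S" "\<omega>' \<in> ?S" "\<omega> \<noteq> \<omega>'"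
      have "scf_inv \<omega> ` ?E \<inter> scf_inv \<omega>' ` ?E = {}"
        using scf_inv_disjoint[OF scf_symbols_uptoD[OF w(1)] scf_symbols_uptoD[OF w(2)] w(3)]
          scf_low_subset[of M n] by blast
      then show "negligible (scf_inv \<omega> ` ?E \<inter> scf_inv \<omega>' ` ?E)" by simp
    qed
  qed
  then have "integral (scf_low M (Suc n)) ?g = (\<Sum>\<omega>\<in>?S. integral (scf_inv \<omega> ` ?E) ?g)"
    unfolding scf_low_Suc by (rule integral_unique)
  also have "\<dots> = (\<Sum>\<omega>\<in>?S. integral ?E (\<lambda>y. scf_prob \<omega> y * f (scf_inv \<omega> y) / scf_weight y))"
    by (intro sum.cong refl scf_inv_integral(2) scf_symbols_uptoD scf_low_borel scf_low_subset assms)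
  also have "\<dots> = integral ?E (\<lambda>y. \<Sum>\<omega>\<in>?S. scf_prob \<omega> y * f (scf_inv \<omega> y) / scf_weight y)"
    by (intro integral_sum[symmetric] finite_scf_symbols_upto scf_inv_integral(1) scf_symbols_uptoD
        scf_low_borel scf_low_subset assms)
  also have "\<dots> = integral ?E (\<lambda>y. scf_op M f y / scf_weight y)"
    unfolding scf_op_def sum_divide_distrib ..
  finally show ?thesis .
qed

lemma scf_low_integral:
  assumes "1 \<le> M" "0 \<le> l" "scf_lip l f"
  shows "integral (scf_low M n) (\<lambda>x. f x / scf_weight x)
     = integral {0..1} (\<lambda>x. (scf_op M ^^ n) f x / scf_weight x)"
  using assms(2,3)
\<comment> \<open>Each step removes the first digit and replaces \<open>f\<close> by
  \<open>scf_op M f\<close>, hence the generality in \<open>f\<close> and \<open>l\<close>.\<close>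
proof (induction n arbitrary: f l)
  case 0
  show ?case by (simp add: scf_low_0_integral)
next
  case (Suc n)
  have "0 \<le> (1 / 4 + ln (2 + sqrt 3) / 2) * l + 3 / real M"
    using Suc.prems(1) ln_2_sqrt_3 by simp
  from Suc.IH[OF this scf_op_lip[OF assms(1) Suc.prems]]
  show ?case unfolding scf_low_integral_Suc[OF scf_lip_continuous[OF Suc.prems(2)]]
    by (simp add: funpow_Suc_right del: funpow.simps)
qed

section \<open>The measure in terms of the coordinate, and the law of the first digit\<close>

lemma scf_measure_eq_integral:
  assumes "E \<in> sets borel" "E \<subseteq> {0..1}"
  shows "measure scf_measure E = 2 / ln (2 + sqrt 3) * integral E (\<lambda>x. 1 / scf_weight x)"
proof -
  have pos: "0 \<le> scf_density x" if "x \<in> {0..1}" for x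
    unfolding scf_density_def scf_weight_def[symmetric]
    using scf_weight_pos[of x] that ln_2_sqrt_3 by simp
  have "(\<lambda>x. 1 / scf_weight x) integrable_on E"
    using scf_weighted_integrable[OF continuous_on_const assms]
    by (rule set_lebesgue_integral_eq_integral(1))
  then have "((\<lambda>x. 2 / ln (2 + sqrt 3) * (1 / scf_weight x)) has_integral
     2 / ln (2 + sqrt 3) * integral E (\<lambda>x. 1 / scf_weight x)) E"
    by (intro has_integral_mult_right integrable_integral)
  then have I: "(scf_density has_integral 2 / ln (2 + sqrt 3) * integral E (\<lambda>x. 1 / scf_weight x)) E"
    unfolding scf_density_def[abs_def] scf_weight_def[symmetric] .
  have nn: "0 \<le> 2 / ln (2 + sqrt 3) * integral E (\<lambda>x. 1 / scf_weight x)"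
    using I by (rule has_integral_nonneg) (use pos assms in auto)
  have "emeasure scf_measure E = (\<integral>\<^sup>+ x. ennreal (indicator {0..1} x * scf_density x) * indicator E x \<partial>lborel)"
    unfolding scf_measure_def using assms
    by (intro emeasure_density) (auto simp: scf_density_def[abs_def])
  also have "\<dots> = (\<integral>\<^sup>+ x. ennreal (scf_density x) * indicator E x \<partial>lborel)"
    using assms(2) by (intro nn_integral_cong) (auto simp: indicator_def)
  also have "\<dots> = ennreal (2 / ln (2 + sqrt 3) * integral E (\<lambda>x. 1 / scf_weight x))"
    by (rule nn_integral_has_integral_lebesgue'[OF pos I]) (use assms in auto)
  finally show ?thesis unfolding measure_def using nn by simp
qed

lemma scf_coord_integral:
  assumes "0 \<le> a" "a \<le> b" "b \<le> 1"
  shows "integral {a..b} (\<lambda>x. 1 / scf_weight x) = (scf_coord b - scf_coord a) / 2"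
proof -
  have "((\<lambda>x. 2 / scf_weight x) has_integral (scf_coord b - scf_coord a)) {a..b}"
    using assms
    by (intro fundamental_theorem_of_calculus)
      (auto simp flip: has_real_derivative_iff_has_vector_derivative intro!: scf_coord_deriv)
  from has_integral_divide[OF this, of 2] have
    "((\<lambda>x. 1 / scf_weight x) has_integral (scf_coord b - scf_coord a) / 2) {a..b}" by simp
  then show ?thesis by (rule integral_unique)
qed

text \<open>Indices grow towards both 0 and 1, so a bound on the first digit cuts out a single
  interval. In the codes of \<open>scf_interval_code\<close> the largest admissible floor is
  \<open>2 * M\<close> on the even side and \<open>2 * M - 1\<close> on the odd side.\<close>

lemma scf_symbol_of_le_iff:
  assumes "1 \<le> M" "x \<in> {0<..<1} - \<rat>"
  shows "fst (scf_symbol_of x) \<le> M \<longleftrightarrow> 1 / (2 * real M + 1) < x \<and> x < real M / (real M + 1)"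
proof -
  obtain \<omega> where w: "\<omega> \<in> scf_alphabet" "x \<in> scf_interval \<omega>"
    using scf_interval_exists[OF assms(2)] by blast
  have s: "scf_symbol_of x = \<omega>" using scf_symbol_of_eq[OF assms(2) w] .
  obtain k \<epsilon> p where kp: "\<omega> = (k, \<epsilon>, p)" by (cases \<omega>)
  note c = scf_interval_code[OF w(1) assms(2) w(2)]
  have x: "0 < x" "x < 1" using assms by auto
  have M: "1 \<le> real M" using assms by simp
  show ?thesis
  proof (cases p)
    case Par_e
    then have h: "x < 1 / 2" using c(1) kp by simp
    have "1 / 2 \<le> real M / (real M + 1)" using M by (simp add: field_simps)
    with h have h': "x < real M / (real M + 1)" by linarith
    have f: "\<lfloor>1 / x\<rfloor> = (if \<epsilon> = 1 then 2 * int k else 2 * int k - 1)"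
      using c(2) Par_e unfolding kp fst_conv snd_conv by blast
    have "k \<le> M \<longleftrightarrow> \<lfloor>1 / x\<rfloor> < 2 * int M + 1" unfolding f by auto
    also have "\<dots> \<longleftrightarrow> 1 / x < 2 * real M + 1" unfolding floor_less_iff by simp
    also have "\<dots> \<longleftrightarrow> 1 / (2 * real M + 1) < x" using x by (auto simp: field_simps)
    finally show ?thesis using h' s kp by simp
  next
    case Par_o
    then have h: "\<not> x < 1 / 2" using c(1) kp by simp
    have "1 / (2 * real M + 1) < 1 / 2" using M by (simp add: field_simps)
    with h have h': "1 / (2 * real M + 1) < x" by linarith
    have f: "\<lfloor>2 * x / (1 - x)\<rfloor> = (if \<epsilon> = 1 then 2 * int k - 1 else 2 * int k - 2)"
      using c(3) Par_o unfolding kp fst_conv snd_conv by blast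
    have "k \<le> M \<longleftrightarrow> \<lfloor>2 * x / (1 - x)\<rfloor> < 2 * int M" unfolding f by auto
    also have "\<dots> \<longleftrightarrow> 2 * x / (1 - x) < 2 * real M" unfolding floor_less_iff by simp
    also have "\<dots> \<longleftrightarrow> x < real M / (real M + 1)" using x by (auto simp: field_simps)
    finally show ?thesis using h' s kp by simp
  qed
qed

lemma scf_low_1_integral:
  assumes "1 \<le> M"
  shows "integral (scf_low M 1) (\<lambda>x. 1 / scf_weight x)
    = (scf_coord (real M / (real M + 1)) - scf_coord (1 / (2 * real M + 1))) / 2"
proof -
  let ?a = "1 / (2 * real M + 1)" and ?b = "real M / (real M + 1)"
  have "?a \<le> 1 / 2" "1 / 2 \<le> ?b" using assms by (auto simp: field_simps)
  then have "?a \<le> ?b" by linarith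
  then have ab: "0 < ?a" "?a \<le> ?b" "?b < 1" by simp_all
  have low: "scf_low M 1 = {?a<..<?b} - \<rat>"
  proof -
    have "{?a<..<?b} \<subseteq> {0<..<1}"
      using ab by (intro greaterThanLessThan_subseteq_greaterThanLessThan[THEN iffD2] impI conjI) linarith+
    then show ?thesis using scf_symbol_of_le_iff[OF assms] unfolding scf_low_def by auto
  qed
  have "integral (scf_low M 1) (\<lambda>x. 1 / scf_weight x) = integral {?a..?b} (\<lambda>x. 1 / scf_weight x)"
  proof (rule integral_subset_negligible)
    have "negligible (\<rat> \<union> {?a, ?b})" using negligible_rat by simp
    then show "negligible ({?a..?b} - scf_low M 1)"
      by (rule negligible_subset) (auto simp: low[unfolded One_nat_def])
  qed (auto simp: low[unfolded One_nat_def])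
  then show ?thesis using scf_coord_integral[of ?a ?b] ab by simp
qed

section \<open>The limit law\<close>

definition scf_mean :: "(real \<Rightarrow> real) \<Rightarrow> real" where
  "scf_mean f = 2 / ln (2 + sqrt 3) * integral {0..1} (\<lambda>x. f x / scf_weight x)"

text \<open>The measure of the set where the first digit exceeds \<open>M\<close>, the
  \<open>q\<close> of the overview.\<close>

definition scf_tail_mass :: "nat \<Rightarrow> real" where
  "scf_tail_mass M = 1 - 2 / ln (2 + sqrt 3) * integral (scf_low M 1) (\<lambda>x. 1 / scf_weight x)"

lemma scf_weighted_integrable_on:
  assumes "continuous_on {0..1} f" "E \<in> sets borel" "E \<subseteq> {0..1}"
  shows "(\<lambda>x. f x / scf_weight x) integrable_on E"
  using scf_weighted_integrable[OF assms] by (rule set_lebesgue_integral_eq_integral(1))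

lemma scf_mean_const: "scf_mean (\<lambda>_. c) = c"
proof -
  have "integral {0..1} (\<lambda>x. c / scf_weight x) = c * integral {0..1} (\<lambda>x. 1 / scf_weight x)"
    by (simp flip: integral_mult_right)
  also have "integral {0..1} (\<lambda>x. 1 / scf_weight x) = ln (2 + sqrt 3) / 2"
    using scf_coord_integral[of 0 1] by (simp add: scf_coord_0 scf_coord_1)
  finally show ?thesis unfolding scf_mean_def using ln_2_sqrt_3 by (simp add: field_simps)
qed

lemma scf_mean_mono:
  assumes "continuous_on {0..1} f" "continuous_on {0..1} g" "\<And>x. x \<in> {0..1} \<Longrightarrow> f x \<le> g x"
  shows "scf_mean f \<le> scf_mean g"
  unfolding scf_mean_def
proof (intro mult_left_mono integral_le scf_weighted_integrable_on assms)
  show "f x / scf_weight x \<le> g x / scf_weight x" if "x \<in> {0..1}" for x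
    using that assms(3) scf_weight_pos[of x] by (intro divide_right_mono) auto
qed (use ln_2_sqrt_3 in auto)

lemma scf_lip_near_mean:
  assumes "0 \<le> l" "scf_lip l f" "x \<in> {0..1}"
  shows "\<bar>f x - scf_mean f\<bar> \<le> l * ln (2 + sqrt 3)"
proof -
  let ?e = "l * ln (2 + sqrt 3)"
  have *: "\<bar>f x - f z\<bar> \<le> ?e" if "z \<in> {0..1}" for z
  proof -
    have "\<bar>f x - f z\<bar> \<le> l * \<bar>scf_coord x - scf_coord z\<bar>"
      using assms that unfolding scf_lip_def by blast
    also have "\<dots> \<le> ?e" using assms scf_coord_diam that by (intro mult_left_mono) auto
    finally show ?thesis .
  qed
  note c = scf_lip_continuous[OF assms(2)]
  have "scf_mean (\<lambda>_. f x - ?e) \<le> scf_mean f" "scf_mean f \<le> scf_mean (\<lambda>_. f x + ?e)"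
    using * by (intro scf_mean_mono continuous_on_const c; force simp: abs_le_iff)+
  then show ?thesis unfolding scf_mean_const by (simp add: abs_le_iff)
qed

text \<open>The left side is the integral of \<open>f\<close> minus its mean over the set where the
  first digit is at most \<open>M\<close>. The integral over everything is 0, so this equals minus
  the integral over the complement, of measure \<open>scf_tail_mass M\<close>. This yields the
  factor \<open>scf_tail_mass M\<close> in the error.\<close>

lemma scf_mean_op:
  assumes "1 \<le> M" "0 \<le> l" "scf_lip l f"
  shows "\<bar>scf_mean (scf_op M f) - (1 - scf_tail_mass M) * scf_mean f\<bar>
    \<le> l * ln (2 + sqrt 3) * scf_tail_mass M"
proof -
  let ?L = "ln (2 + sqrt 3)" and ?c = "scf_mean f" and ?q = "scf_tail_mass M"
  let ?e = "l * ?L"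
  define E where "E = scf_low M 1"
  define B where "B g = 2 / ?L * integral E (\<lambda>x. g x / scf_weight x)" for g
  note c = scf_lip_continuous[OF assms(3)]
  have i: "(\<lambda>x. g x / scf_weight x) integrable_on E" "(\<lambda>x. g x / scf_weight x) integrable_on {0..1}"
    if "continuous_on {0..1} g" for g
    unfolding E_def by (intro scf_weighted_integrable_on that scf_low_borel scf_low_subset_01; simp)+
  have Bop: "B f = scf_mean (scf_op M f)"
    using scf_low_integral[OF assms, of 1] unfolding B_def scf_mean_def E_def by simp
  have B1: "B (\<lambda>_. a) = a * (1 - ?q)" for a
  proof -
    have "integral E (\<lambda>x. a / scf_weight x) = a * integral E (\<lambda>x. 1 / scf_weight x)"
      by (simp flip: integral_mult_right)
    then show ?thesis unfolding B_def scf_tail_mass_def E_def[symmetric] by (simp add: field_simps)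
  qed
  have Badd: "B (\<lambda>x. a + s * f x) = a * (1 - ?q) + s * B f"
    and Aadd: "scf_mean (\<lambda>x. a + s * f x) = a + s * ?c" for a s
  proof -
    have e: "(\<lambda>x. (a + s * f x) / scf_weight x) = (\<lambda>x. a / scf_weight x + s * (f x / scf_weight x))"
      by (simp add: add_divide_distrib)
    have "integral E (\<lambda>x. (a + s * f x) / scf_weight x) =
      integral E (\<lambda>x. a / scf_weight x) + integral E (\<lambda>x. s * (f x / scf_weight x))"
      unfolding e by (intro integral_add i[of "\<lambda>_. a"] integrable_on_mult_right i c continuous_on_const)
    also have "integral E (\<lambda>x. s * (f x / scf_weight x)) = s * integral E (\<lambda>x. f x / scf_weight x)"
      by (rule integral_mult_right)
    finally have "integral E (\<lambda>x. (a + s * f x) / scf_weight x) =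
      integral E (\<lambda>x. a / scf_weight x) + s * integral E (\<lambda>x. f x / scf_weight x)" .
    then show "B (\<lambda>x. a + s * f x) = a * (1 - ?q) + s * B f"
      unfolding B1[symmetric] unfolding B_def by (simp add: algebra_simps)
    have "integral {0..1} (\<lambda>x. (a + s * f x) / scf_weight x) =
      integral {0..1} (\<lambda>x. a / scf_weight x) + integral {0..1} (\<lambda>x. s * (f x / scf_weight x))"
      unfolding e by (intro integral_add i[of "\<lambda>_. a"] integrable_on_mult_right i c continuous_on_const)
    also have "integral {0..1} (\<lambda>x. s * (f x / scf_weight x)) = s * integral {0..1} (\<lambda>x. f x / scf_weight x)"
      by (rule integral_mult_right)
    finally have "integral {0..1} (\<lambda>x. (a + s * f x) / scf_weight x) =
      integral {0..1} (\<lambda>x. a / scf_weight x) + s * integral {0..1} (\<lambda>x. f x / scf_weight x)" .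
    then have "scf_mean (\<lambda>x. a + s * f x) = scf_mean (\<lambda>_. a) + s * ?c"
      unfolding scf_mean_def by (simp add: algebra_simps)
    then show "scf_mean (\<lambda>x. a + s * f x) = a + s * ?c" unfolding scf_mean_const .
  qed
  have BA: "B (\<lambda>x. a + s * f x) \<le> scf_mean (\<lambda>x. a + s * f x)"
    if "\<And>x. x \<in> {0..1} \<Longrightarrow> 0 \<le> a + s * f x" for a s
    unfolding B_def scf_mean_def
  proof (intro mult_left_mono integral_subset_le i ballI)
    show "0 \<le> (a + s * f x) / scf_weight x" if "x \<in> {0..1}" for x
      using that \<open>\<And>x. x \<in> {0..1} \<Longrightarrow> 0 \<le> a + s * f x\<close> scf_weight_pos[of x] by auto
  qed (use ln_2_sqrt_3 scf_low_subset_01 c in \<open>auto simp: E_def intro!: continuous_intros\<close>)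
  have n: "\<bar>f x - ?c\<bar> \<le> ?e" if "x \<in> {0..1}" for x using scf_lip_near_mean[OF assms(2,3) that] .
  \<comment> \<open>\<open>?c + ?e - f\<close> is nonnegative with mean \<open>?e\<close>. That its
    integral over \<open>E\<close> is at most \<open>?e\<close> rearranges to a lower bound for
    \<open>B f\<close> with error \<open>?e * ?q\<close>; the next step gives the upper
    bound.\<close>
  have "B (\<lambda>x. (?c + ?e) + (-1) * f x) \<le> scf_mean (\<lambda>x. (?c + ?e) + (-1) * f x)"
    using n by (intro BA) (force simp: abs_le_iff)
  moreover have "B (\<lambda>x. (?e - ?c) + 1 * f x) \<le> scf_mean (\<lambda>x. (?e - ?c) + 1 * f x)"
    using n by (intro BA) (force simp: abs_le_iff)
  ultimately show ?thesis unfolding Badd Aadd Bop[symmetric] abs_le_iff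
    by (simp add: algebra_simps)
qed

lemma scf_tail_mass_bounds:
  assumes "1 \<le> M" shows "0 \<le> scf_tail_mass M" "scf_tail_mass M \<le> 1"
proof -
  let ?a = "1 / (2 * real M + 1)" and ?b = "real M / (real M + 1)"
  have "?a \<le> 1 / 2" "1 / 2 \<le> ?b" using assms by (auto simp: field_simps)
  then have ab: "?a \<le> ?b" by linarith
  have q: "scf_tail_mass M = 1 - (scf_coord ?b - scf_coord ?a) / ln (2 + sqrt 3)"
  proof -
    have "2 / L * (t / 2) = t / L" for t L :: real by simp
    then show ?thesis unfolding scf_tail_mass_def scf_low_1_integral[OF assms] by (simp only:)
  qed
  have "scf_coord ?a \<le> scf_coord ?b" using ab by (intro scf_coord_mono) auto
  moreover have "scf_coord 0 \<le> scf_coord ?a" "scf_coord ?b \<le> scf_coord 1"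
    by (intro scf_coord_mono; simp)+
  ultimately show "0 \<le> scf_tail_mass M" "scf_tail_mass M \<le> 1"
    unfolding q using ln_2_sqrt_3 by (auto simp: scf_coord_0 scf_coord_1 field_simps)
qed

text \<open>The factor \<open>1 - scf_tail_mass M\<close> lies between 0 and 1, so earlier errors do
  not grow and the one-step errors of \<open>scf_mean_op\<close> add up.\<close>

lemma scf_mean_iterate:
  assumes "1 \<le> M"
  defines "l \<equiv> 3 / (real M * (3 / 4 - ln (2 + sqrt 3) / 2))"
  shows "\<bar>scf_mean ((scf_op M ^^ n) (\<lambda>_. 1)) - (1 - scf_tail_mass M) ^ n\<bar>
    \<le> real n * (l * ln (2 + sqrt 3) * scf_tail_mass M)"
proof (induction n)
  case 0
  show ?case by (simp add: scf_mean_const)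
next
  case (Suc n)
  let ?q = "scf_tail_mass M" and ?m = "scf_mean ((scf_op M ^^ n) (\<lambda>_. 1))"
    and ?e = "l * ln (2 + sqrt 3) * scf_tail_mass M"
  have l: "0 \<le> l" unfolding l_def using ln_2_sqrt_3 by simp
  have 1: "\<bar>scf_mean ((scf_op M ^^ Suc n) (\<lambda>_. 1)) - (1 - ?q) * ?m\<bar> \<le> ?e"
    using scf_mean_op[OF assms(1) l scf_op_iterate_lip[OF assms(1), folded l_def]] by simp
  have "\<bar>(1 - ?q) * ?m - (1 - ?q) ^ Suc n\<bar> = (1 - ?q) * \<bar>?m - (1 - ?q) ^ n\<bar>"
    using scf_tail_mass_bounds[OF assms(1)] by (simp add: abs_mult flip: right_diff_distrib)
  also have "\<dots> \<le> 1 * \<bar>?m - (1 - ?q) ^ n\<bar>"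
    using scf_tail_mass_bounds[OF assms(1)] by (intro mult_right_mono) auto
  also have "\<dots> = \<bar>?m - (1 - ?q) ^ n\<bar>" by simp
  also note Suc.IH
  finally have "\<bar>(1 - ?q) * ?m - (1 - ?q) ^ Suc n\<bar> \<le> real n * ?e" .
  with 1 show ?case by (simp add: algebra_simps)
qed

lemma scf_measure_low:
  assumes "1 \<le> M"
  shows "measure scf_measure (scf_low M n) = scf_mean ((scf_op M ^^ n) (\<lambda>_. 1))"
proof -
  have "scf_lip 0 (\<lambda>_. 1)" by (simp add: scf_lip_def)
  then show ?thesis
    unfolding scf_mean_def scf_measure_eq_integral[OF scf_low_borel scf_low_subset_01]
    using scf_low_integral[OF assms, of 0 "\<lambda>_. 1"] by simp
qed

text \<open>The discarded set consists of two end pieces, of lengths about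
  \<open>1 / (2 * M)\<close> at 0 and \<open>1 / M\<close> at 1. The coordinate has derivative 2 at
  0 and 1 at 1, so each piece has coordinate length about \<open>1 / M\<close>.\<close>

lemma scf_tail_mass_asymp: "(\<lambda>M. real M * scf_tail_mass M) \<longlonglongrightarrow> 2 / ln (2 + sqrt 3)"
proof -
  let ?a = "\<lambda>M. 1 / (2 * real M + 1)" and ?b = "\<lambda>M. real M / (real M + 1)" and ?L = "ln (2 + sqrt 3)"
  have D0: "((\<lambda>y. (scf_coord y - scf_coord 0) / (y - 0)) \<longlongrightarrow> 2) (at 0)"
    using scf_coord_deriv[of 0 UNIV] unfolding has_field_derivative_iff by (simp add: scf_weight_def)
  have "filterlim ?a (at 0) sequentially"
    unfolding filterlim_at by (intro conjI eventually_sequentiallyI[of 1]) (simp, simp add: field_simps, real_asymp)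
  from filterlim_compose[OF D0 this]
  have "(\<lambda>M. scf_coord (?a M) / ?a M) \<longlonglongrightarrow> 2" by (simp add: scf_coord_0)
  moreover have "(\<lambda>M. real M * ?a M) \<longlonglongrightarrow> 1 / 2" by real_asymp
  ultimately have 0: "(\<lambda>M. (scf_coord (?a M) / ?a M) * (real M * ?a M)) \<longlonglongrightarrow> 2 * (1 / 2)"
    by (rule tendsto_mult)
  have w1: "scf_weight 1 = 2" by (simp add: scf_weight_eq)
  have D1: "((\<lambda>y. (scf_coord y - scf_coord 1) / (y - 1)) \<longlongrightarrow> 1) (at 1)"
    using scf_coord_deriv[of 1 UNIV] unfolding has_field_derivative_iff by (simp add: w1)
  have "filterlim ?b (at 1) sequentially"
    unfolding filterlim_at by (intro conjI eventually_sequentiallyI[of 1]) (simp, simp add: field_simps, real_asymp)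
  from filterlim_compose[OF D1 this]
  have "(\<lambda>M. (scf_coord (?b M) - ?L) / (?b M - 1)) \<longlonglongrightarrow> 1" by (simp add: scf_coord_1)
  moreover have "(\<lambda>M. real M * (1 - ?b M)) \<longlonglongrightarrow> 1" by real_asymp
  ultimately have 1: "(\<lambda>M. ((scf_coord (?b M) - ?L) / (?b M - 1)) * (real M * (1 - ?b M))) \<longlonglongrightarrow> 1 * 1"
    by (rule tendsto_mult)
  have "(\<lambda>M. ((scf_coord (?a M) / ?a M) * (real M * ?a M) +
      ((scf_coord (?b M) - ?L) / (?b M - 1)) * (real M * (1 - ?b M))) / ?L) \<longlonglongrightarrow> (2 * (1 / 2) + 1 * 1) / ?L"
    using ln_2_sqrt_3 by (intro tendsto_divide tendsto_add 0 1 tendsto_const) auto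
  then have lim: "(\<lambda>M. ((scf_coord (?a M) / ?a M) * (real M * ?a M) +
      ((scf_coord (?b M) - ?L) / (?b M - 1)) * (real M * (1 - ?b M))) / ?L) \<longlonglongrightarrow> 2 / ?L" by simp
  show ?thesis
  proof (rule Lim_transform_eventually[OF lim eventually_sequentiallyI[of 1]])
    fix M :: nat assume M: "1 \<le> M"
    have "scf_coord (?a M) / ?a M * (real M * ?a M) = real M * scf_coord (?a M)" by simp
    moreover have "(u / (b - 1)) * (m * (1 - b)) = - (m * u)" if "b \<noteq> 1" for u m b :: real
      using that by (simp add: field_simps)
    then have "((scf_coord (?b M) - ?L) / (?b M - 1)) * (real M * (1 - ?b M)) =
       - (real M * (scf_coord (?b M) - ?L))" by simp
    ultimately show "((scf_coord (?a M) / ?a M) * (real M * ?a M) +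
      ((scf_coord (?b M) - ?L) / (?b M - 1)) * (real M * (1 - ?b M))) / ?L = real M * scf_tail_mass M"
      unfolding scf_tail_mass_def scf_low_1_integral[OF M] using ln_2_sqrt_3
      by (simp only:) (simp add: field_simps)
  qed
qed

lemma power_one_minus_tendsto:
  fixes q :: "nat \<Rightarrow> real"
  assumes "(\<lambda>n. real n * q n) \<longlonglongrightarrow> a" "\<forall>\<^sub>F n in sequentially. 0 \<le> q n \<and> q n \<le> 1" "0 \<le> a"
  shows "(\<lambda>n. (1 - q n) ^ n) \<longlonglongrightarrow> exp (- a)"
proof -
  have "(\<lambda>n. \<bar>a - real n * q n\<bar>) \<longlonglongrightarrow> \<bar>a - a\<bar>" by (intro tendsto_intros assms)
  then have z: "(\<lambda>n. \<bar>a - real n * q n\<bar>) \<longlonglongrightarrow> 0" by simp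
  have "\<forall>\<^sub>F n in sequentially. norm ((1 - q n) ^ n - (1 + (- a) / real n) ^ n) \<le> \<bar>a - real n * q n\<bar>"
    \<comment> \<open>For \<open>n \<ge> a\<close> the base \<open>1 - a / n\<close> lies between 0
      and 1, as \<open>norm_power_diff\<close> requires of both bases.\<close>
    using assms(2) eventually_gt_at_top[of "nat \<lceil>a\<rceil>"]
  proof eventually_elim
    case (elim n)
    then have n: "0 < real n" "a \<le> real n" by linarith+
    have "norm ((1 - q n) ^ n - (1 + (- a) / real n) ^ n) \<le> real n * norm ((1 - q n) - (1 + (- a) / real n))"
      using elim n assms(3) by (intro norm_power_diff) (auto simp: field_simps)
    also have "\<dots> = \<bar>real n * ((1 - q n) - (1 + (- a) / real n))\<bar>" by (simp add: abs_mult)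
    also have "real n * ((1 - q n) - (1 + (- a) / real n)) = a - real n * q n"
      using n by (simp add: field_simps)
    finally show ?case .
  qed
  then have "(\<lambda>n. (1 - q n) ^ n - (1 + (- a) / real n) ^ n) \<longlonglongrightarrow> 0"
    using z by (rule Lim_null_comparison)
  from tendsto_add[OF this tendsto_exp_limit_sequentially[of "- a"]] show ?thesis by simp
qed

lemma scf_max_set_eq:
  assumes "1 \<le> N" "0 \<le> c"
  shows "{x \<in> {0<..<1}. x \<notin> \<rat> \<and> real (Max ((\<lambda>n. scf_a n x) ` {1..N})) \<le> c} = scf_low (nat \<lfloor>c\<rfloor>) N"
proof -
  have f: "real m \<le> c \<longleftrightarrow> m \<le> nat \<lfloor>c\<rfloor>" for m using assms(2) by linarith
  have "(real (Max ((\<lambda>n. scf_a n x) ` {1..N})) \<le> c) \<longleftrightarrow>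
     (\<forall>j<N. fst (scf_symbol_of ((scf_map ^^ j) x)) \<le> nat \<lfloor>c\<rfloor>)" for x
  proof -
    have "(real (Max ((\<lambda>n. scf_a n x) ` {1..N})) \<le> c) \<longleftrightarrow> (\<forall>n\<in>{1..N}. scf_a n x \<le> nat \<lfloor>c\<rfloor>)"
      unfolding f using assms(1) by (subst Max_le_iff) auto
    also have "\<dots> \<longleftrightarrow> (\<forall>j<N. scf_a (Suc j) x \<le> nat \<lfloor>c\<rfloor>)"
      unfolding image_Suc_lessThan[symmetric] by auto
    finally show ?thesis by (simp add: scf_a_def scf_digit_def)
  qed
  then show ?thesis by (auto simp: scf_low_def)
qed

theorem theorem1p1:
  fixes y :: real
  assumes "y > 0"
  shows "(\<lambda>N. measure scf_measure
            {x \<in> {0<..<1}. x \<notin> \<rat> \<and>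
               real (Max ((\<lambda>n. scf_a n x) ` {1..N})) \<le> 2 * real N * y / ln (2 + sqrt 3)})
         \<longlonglongrightarrow> exp (- (1 / y))"
proof -
  define L where "L = ln (2 + sqrt 3)"
  define c where "c = 2 * y / L"
  define M where "M N = nat \<lfloor>2 * real N * y / L\<rfloor>" for N :: nat
  define q where "q N = scf_tail_mass (M N)" for N
  \<comment> \<open>\<open>K / M N\<close> is the Lipschitz constant of
    \<open>scf_op_iterate_lip\<close> times the coordinate diameter.\<close>
  define K where "K = 3 / (3 / 4 - L / 2) * L"
  have L: "0 < L" "L < 3 / 2" unfolding L_def by (rule ln_2_sqrt_3)+
  have c: "0 < c" unfolding c_def using L assms by simp
  have M_eq: "M N = nat \<lfloor>real N * c\<rfloor>" for N unfolding M_def c_def by (simp add: mult_ac)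
  have Mlim: "filterlim M at_top sequentially"
    unfolding M_eq[abs_def] using c by real_asymp
  have ratio: "(\<lambda>N. real N / real (M N)) \<longlonglongrightarrow> inverse c"
    unfolding M_eq[abs_def] using c by real_asymp
  have "(\<lambda>N. real (M N) * q N) \<longlonglongrightarrow> 2 / L"
    unfolding q_def L_def using filterlim_compose[OF scf_tail_mass_asymp Mlim] by simp
  \<comment> \<open>The limit is \<open>inverse c * (2 / L) = 1 / y\<close>, which explains the
    normalisation of the threshold.\<close>
  from tendsto_mult[OF ratio this]
  have "(\<lambda>N. real N / real (M N) * (real (M N) * q N)) \<longlonglongrightarrow> 1 / y"
    using L assms by (simp add: c_def field_simps)
  moreover have M1: "\<forall>\<^sub>F N in sequentially. 1 \<le> M N"
    using Mlim unfolding filterlim_at_top by blast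
  ultimately have Nq: "(\<lambda>N. real N * q N) \<longlonglongrightarrow> 1 / y"
    by (rule Lim_transform_eventually[OF _ eventually_mono]) auto
  have "\<forall>\<^sub>F N in sequentially. 0 \<le> q N \<and> q N \<le> 1"
    using M1 by eventually_elim (simp add: q_def scf_tail_mass_bounds)
  from power_one_minus_tendsto[OF Nq this]
  have lim: "(\<lambda>N. (1 - q N) ^ N) \<longlonglongrightarrow> exp (- (1 / y))" using assms by simp
  have "(\<lambda>N. inverse (real (M N))) \<longlonglongrightarrow> 0"
    by (intro tendsto_inverse_0_at_top filterlim_compose[OF filterlim_real_sequentially Mlim])
  from tendsto_mult[OF tendsto_mult[OF tendsto_const[of K] this] Nq]
  have err: "(\<lambda>N. K * inverse (real (M N)) * (real N * q N)) \<longlonglongrightarrow> 0" by simp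
  let ?m = "\<lambda>N. measure scf_measure {x \<in> {0<..<1}. x \<notin> \<rat> \<and>
      real (Max ((\<lambda>n. scf_a n x) ` {1..N})) \<le> 2 * real N * y / L}"
  have "\<forall>\<^sub>F N in sequentially. norm (?m N - (1 - q N) ^ N) \<le> K * inverse (real (M N)) * (real N * q N)"
    using M1 eventually_ge_at_top[of 1]
  proof eventually_elim
    case (elim N)
    have "0 \<le> 2 * real N * y / L" using L assms by simp
    then have "?m N = scf_mean ((scf_op (M N) ^^ N) (\<lambda>_. 1))"
      using scf_max_set_eq[OF elim(2)] scf_measure_low[OF elim(1)] unfolding M_def by simp
    then show ?case using scf_mean_iterate[OF elim(1), of N] unfolding q_def K_def L_def
      by (simp add: field_simps)
  qed
  from tendsto_add[OF Lim_null_comparison[OF this err] lim]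
  show ?thesis unfolding L_def by simp
qed

end
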